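(* Let $G$ be a group acting by isometries on a $\delta$-hyperbolic geodesic metric space $X$ with $\delta\ge1$, and let $\mathcal{C}=(C,\{G_c\mid c\in C\})$ be a $\rho$-separated fairly rotating family with $\rho\ge 2\delta\log_2(\delta)+38\delta$. Then the normal closure in $G$ of $\bigcup_{c\in C}G_c$ is isomorphic to a free product $\ast_{c\in C'}G_c$ for some subset $C'\subseteq C$.
   Context: A geodesic metric space is $\delta$-hyperbolic if every geodesic triangle is $\delta$-thin (points of the triangle with the same image in the comparison tripod are at distance $\le\delta$). A rotating family $\mathcal{C}=(C,\{G_c\})$ consists of a $G$-invariant subset $C\subseteq X$ and subgroups $G_c\le G$ with $G_c$ fixing $c$ and $G_{gc}=gG_cg^{-1}$ for all $g\in G$, $c\in C$. It is $\rho$-separated if distinct points of $C$ are at distance $\ge\rho$. It is fairly rotating if for all $c\in C$, $g\in G_c\setminus\{1\}$ and $x\in C\setminus\{c\}$, some geodesic from $x$ to $gx$ meets the closed ball of radius $1$ about $c$. *)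

theory Defs
  imports "HOL-Analysis.Analysis" "HOL-Algebra.Group_Action" "HOL-Algebra.Generated_Groups"
begin

definition geodesic :: "(real \<Rightarrow> 'a::metric_space) \<Rightarrow> 'a \<Rightarrow> 'a \<Rightarrow> bool" where
  "geodesic \<gamma> x y \<longleftrightarrow> \<gamma> 0 = x \<and> \<gamma> (dist x y) = y \<and>
     (\<forall>s\<in>{0..dist x y}. \<forall>t\<in>{0..dist x y}. dist (\<gamma> s) (\<gamma> t) = \<bar>s - t\<bar>)"

definition geodesic_space :: "'a::metric_space itself \<Rightarrow> bool" where
  "geodesic_space TYPE('a) \<longleftrightarrow> (\<forall>x y::'a. \<exists>\<gamma>. geodesic \<gamma> x y)"

text \<open>Gromov product (y|z)_x: the leg length at x of the comparison tripod.\<close>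
definition gromov_product :: "'a::metric_space \<Rightarrow> 'a \<Rightarrow> 'a \<Rightarrow> real" where
  "gromov_product x y z = (dist x y + dist x z - dist y z) / 2"

text \<open>The geodesic triangle with sides gxy (from x to y), gyz (from y to z),
  gzx (from z to x) is delta-thin: points with the same image in the comparison
  tripod are at distance at most delta. The point of gab at distance t from b is
  gab (dist a b - t).\<close>
definition thin_triangle :: "real \<Rightarrow> 'a::metric_space \<Rightarrow> 'a \<Rightarrow> 'a \<Rightarrow>
    (real \<Rightarrow> 'a) \<Rightarrow> (real \<Rightarrow> 'a) \<Rightarrow> (real \<Rightarrow> 'a) \<Rightarrow> bool" where
  "thin_triangle \<delta> x y z gxy gyz gzx \<longleftrightarrow>
     (\<forall>t\<in>{0..gromov_product x y z}. dist (gxy t) (gzx (dist z x - t)) \<le> \<delta>) \<and>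
     (\<forall>t\<in>{0..gromov_product y z x}. dist (gyz t) (gxy (dist x y - t)) \<le> \<delta>) \<and>
     (\<forall>t\<in>{0..gromov_product z x y}. dist (gzx t) (gyz (dist y z - t)) \<le> \<delta>)"

definition hyperbolic :: "'a::metric_space itself \<Rightarrow> real \<Rightarrow> bool" where
  "hyperbolic TYPE('a) \<delta> \<longleftrightarrow>
     (\<forall>(x::'a) y z gxy gyz gzx. geodesic gxy x y \<and> geodesic gyz y z \<and> geodesic gzx z x
        \<longrightarrow> thin_triangle \<delta> x y z gxy gyz gzx)"

definition isometric_action :: "('g, 'b) monoid_scheme \<Rightarrow> ('g \<Rightarrow> 'a::metric_space \<Rightarrow> 'a) \<Rightarrow> bool" where
  "isometric_action G \<phi> \<longleftrightarrow> group_action G UNIV \<phi> \<and>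
     (\<forall>g\<in>carrier G. \<forall>x y. dist (\<phi> g x) (\<phi> g y) = dist x y)"

definition rotating_family :: "('g, 'b) monoid_scheme \<Rightarrow> ('g \<Rightarrow> 'a \<Rightarrow> 'a) \<Rightarrow> 'a set \<Rightarrow> ('a \<Rightarrow> 'g set) \<Rightarrow> bool" where
  "rotating_family G \<phi> C Gc \<longleftrightarrow>
     (\<forall>g\<in>carrier G. \<forall>c\<in>C. \<phi> g c \<in> C) \<and>
     (\<forall>c\<in>C. subgroup (Gc c) G \<and> (\<forall>h\<in>Gc c. \<phi> h c = c)) \<and>
     (\<forall>g\<in>carrier G. \<forall>c\<in>C. Gc (\<phi> g c) = (\<lambda>h. g \<otimes>\<^bsub>G\<^esub> h \<otimes>\<^bsub>G\<^esub> inv\<^bsub>G\<^esub> g) ` Gc c)"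

definition separated :: "real \<Rightarrow> 'a::metric_space set \<Rightarrow> bool" where
  "separated \<rho> C \<longleftrightarrow> (\<forall>c\<in>C. \<forall>c'\<in>C. c \<noteq> c' \<longrightarrow> \<rho> \<le> dist c c')"

definition fairly_rotating :: "('g, 'b) monoid_scheme \<Rightarrow> ('g \<Rightarrow> 'a::metric_space \<Rightarrow> 'a) \<Rightarrow> 'a set \<Rightarrow> ('a \<Rightarrow> 'g set) \<Rightarrow> bool" where
  "fairly_rotating G \<phi> C Gc \<longleftrightarrow>
     (\<forall>c\<in>C. \<forall>g\<in>Gc c - {\<one>\<^bsub>G\<^esub>}. \<forall>x\<in>C - {c}.
        \<exists>\<gamma>. geodesic \<gamma> x (\<phi> g x) \<and> (\<exists>t\<in>{0..dist x (\<phi> g x)}. dist (\<gamma> t) c \<le> 1))"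

definition normal_closure :: "('g, 'b) monoid_scheme \<Rightarrow> 'g set \<Rightarrow> 'g set" where
  "normal_closure G S = generate G {g \<otimes>\<^bsub>G\<^esub> s \<otimes>\<^bsub>G\<^esub> inv\<^bsub>G\<^esub> g | g s. g \<in> carrier G \<and> s \<in> S}"

definition reduced_words :: "('g, 'b) monoid_scheme \<Rightarrow> 'i set \<Rightarrow> ('i \<Rightarrow> 'g set) \<Rightarrow> ('i \<times> 'g) list set" where
  "reduced_words G I K = {w. (\<forall>(i, g)\<in>set w. i \<in> I \<and> g \<in> K i \<and> g \<noteq> \<one>\<^bsub>G\<^esub>) \<and>
      (\<forall>n. Suc n < length w \<longrightarrow> fst (w ! n) \<noteq> fst (w ! Suc n))}"

fun push_letter :: "('g, 'b) monoid_scheme \<Rightarrow> 'i \<times> 'g \<Rightarrow> ('i \<times> 'g) list \<Rightarrow> ('i \<times> 'g) list" where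
  "push_letter G (i, g) [] = [(i, g)]"
| "push_letter G (i, g) ((j, h) # w) =
     (if i = j then (if g \<otimes>\<^bsub>G\<^esub> h = \<one>\<^bsub>G\<^esub> then w else (i, g \<otimes>\<^bsub>G\<^esub> h) # w)
      else (i, g) # (j, h) # w)"

definition word_mult :: "('g, 'b) monoid_scheme \<Rightarrow> ('i \<times> 'g) list \<Rightarrow> ('i \<times> 'g) list \<Rightarrow> ('i \<times> 'g) list" where
  "word_mult G v w = foldr (push_letter G) v w"

definition free_product :: "('g, 'b) monoid_scheme \<Rightarrow> 'i set \<Rightarrow> ('i \<Rightarrow> 'g set) \<Rightarrow> ('i \<times> 'g) list monoid" where
  "free_product G I K = \<lparr>carrier = reduced_words G I K, mult = word_mult G, one = []\<rparr>"

end

theory Submission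
  imports Defs
begin

text \<open>Only the four-point inequality and the bound \<open>(x|gx)\<^sub>c \<le> 1\<close> for rotations \<open>g\<close> about \<open>c\<close> enter
  the argument.  By Zorn's lemma there is a maximal set \<open>A\<close> of apices such that reduced words over \<open>A\<close> are
  nontrivial, every apex near the hull of the orbit \<open>W\<close> of \<open>A\<close> lies in \<open>W\<close>, and the group \<open>N\<close>
  generated by the rotations about \<open>A\<close> acts freely on the apices outside \<open>W\<close>.
  If \<open>W\<close> misses an apex, let \<open>L\<close> be the set of apices outside \<open>W\<close> which are almost closest to the
  hull of \<open>W\<close>.  Each of them sees \<open>W \<union> L\<close> in a single direction, so every rotation about it
  makes a turn; a local-to-global argument shows that the translates of \<open>W \<union> L\<close> form a tree pattern,
  and \<open>A\<close> can be enlarged by one point from every \<open>N\<close>-orbit in \<open>L\<close>.  Hence \<open>W\<close> consists of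
  all apices and \<open>N\<close> is the normal closure.\<close>

section \<open>Gromov products\<close>

abbreviation gp :: "'a::metric_space \<Rightarrow> 'a \<Rightarrow> 'a \<Rightarrow> real" where
  "gp \<equiv> gromov_product"

lemma gp_commute: "gp x y z = gp x z y"
  by (simp add: gromov_product_def dist_commute)

lemma gp_add_swap: "gp x y z + gp y x z = dist x y"
  by (simp add: gromov_product_def dist_commute field_simps)

lemma gp_self: "gp x y y = dist x y"
  by (simp add: gromov_product_def)

lemma gp_nonneg: "0 \<le> gp x y z"
  using dist_triangle[of y z x] by (simp add: gromov_product_def dist_commute)

lemma gp_le_dist: "gp x y z \<le> dist x y"
  using gp_add_swap[of x y z] gp_nonneg[of y x z] by linarith

section \<open>Geodesics and the four-point inequality\<close>

lemma geodesic_reverse: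
  assumes "geodesic \<gamma> x y"
  shows "geodesic (\<lambda>t. \<gamma> (dist x y - t)) y x"
  using assms unfolding geodesic_def by (auto simp: dist_commute)

lemma geodesic_dist:
  assumes "geodesic \<gamma> x y" "0 \<le> t" "t \<le> dist x y"
  shows "dist x (\<gamma> t) = t" and "dist (\<gamma> t) y = dist x y - t"
proof -
  have g: "\<gamma> 0 = x" "\<gamma> (dist x y) = y"
    "\<And>s t. s \<in> {0..dist x y} \<Longrightarrow> t \<in> {0..dist x y} \<Longrightarrow> dist (\<gamma> s) (\<gamma> t) = \<bar>s - t\<bar>"
    using assms(1) unfolding geodesic_def by blast+
  show "dist x (\<gamma> t) = t"
    using g(3)[of 0 t] assms(2,3) by (simp add: g(1))
  show "dist (\<gamma> t) y = dist x y - t"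
    using g(3)[of t "dist x y"] assms(2,3) by (simp add: g(2))
qed

text \<open>Follow geodesics from \<open>w\<close> for the time
  \<open>t = min (gp w x y) (gp w y z)\<close>. Thinness puts the points towards \<open>x\<close>
  and \<open>z\<close> within \<delta> of the one towards \<open>y\<close>; the path from
  \<open>x\<close> to \<open>z\<close> through these points gives the bound.\<close>

lemma hyperbolic_four_point:
  fixes w x y z :: "'a::metric_space"
  assumes gs: "geodesic_space TYPE('a)" and hyp: "hyperbolic TYPE('a) \<delta>"
  shows "min (gp w x y) (gp w y z) - \<delta> \<le> gp w x z"
proof -
  have thin: "dist (g1 t) (g2 t) \<le> \<delta>"
    if g1: "geodesic g1 w p" and g2: "geodesic g2 w q" and t: "0 \<le> t" "t \<le> gp w p q"
    for g1 g2 p q t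
  proof -
    obtain g3 where "geodesic g3 p q"
      using gs unfolding geodesic_space_def by blast
    with g1 geodesic_reverse[OF g2]
    have "thin_triangle \<delta> w p q g1 g3 (\<lambda>t. g2 (dist w q - t))"
      using hyp unfolding hyperbolic_def by blast
    then show ?thesis
      using t unfolding thin_triangle_def by (auto simp: dist_commute)
  qed
  obtain gx gy gz where g: "geodesic gx w x" "geodesic gy w y" "geodesic gz w z"
    using gs unfolding geodesic_space_def by blast
  define t where "t = min (gp w x y) (gp w y z)"
  have t: "0 \<le> t" "t \<le> gp w x y" "t \<le> gp w y z"
    by (auto simp: t_def gp_nonneg)
  have "t \<le> dist w x" "t \<le> dist w z"
    using t gp_le_dist[of w x y] gp_le_dist[of w z y] gp_commute[of w z y] by linarith+
  then have d: "dist (gx t) x = dist w x - t" "dist (gz t) z = dist w z - t"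
    using geodesic_dist(2)[OF g(1)] geodesic_dist(2)[OF g(3)] t(1) by blast+
  have "dist (gx t) (gy t) \<le> \<delta>" "dist (gy t) (gz t) \<le> \<delta>"
    using thin g t by blast+
  then have "dist x z \<le> dist w x - t + 2 * \<delta> + (dist w z - t)"
    using d dist_triangle[of x z "gx t"] dist_triangle[of "gx t" z "gy t"]
      dist_triangle[of "gy t" z "gz t"] by (simp add: dist_commute)
  then show ?thesis
    unfolding t_def[symmetric] by (simp add: gromov_product_def field_simps)
qed

text \<open>Going through \<open>\<gamma> t\<close> bounds \<open>dist c x + dist c y\<close> by
  \<open>2 * r + dist x y\<close>.\<close>

lemma geodesic_near_imp_gp_le:
  assumes "geodesic \<gamma> x y" "t \<in> {0..dist x y}" "dist (\<gamma> t) c \<le> r"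
  shows "gp c x y \<le> r"
proof -
  have "dist x (\<gamma> t) = t" "dist (\<gamma> t) y = dist x y - t"
    using geodesic_dist[OF assms(1)] assms(2) by auto
  then show ?thesis
    using assms(3) dist_triangle[of c x "\<gamma> t"] dist_triangle[of c y "\<gamma> t"]
    by (simp add: gromov_product_def dist_commute)
qed

section \<open>Evaluating reduced words\<close>

definition word_eval :: "('g, 'b) monoid_scheme \<Rightarrow> ('i \<times> 'g) list \<Rightarrow> 'g" where
  "word_eval G w = foldr (\<lambda>x h. snd x \<otimes>\<^bsub>G\<^esub> h) w \<one>\<^bsub>G\<^esub>"

lemma word_eval_Nil [simp]: "word_eval G [] = \<one>\<^bsub>G\<^esub>"
  by (simp add: word_eval_def)

lemma word_eval_Cons [simp]: "word_eval G (x # w) = snd x \<otimes>\<^bsub>G\<^esub> word_eval G w"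
  by (simp add: word_eval_def)

lemma reduced_words_Nil [simp]: "[] \<in> reduced_words G I K"
  by (simp add: reduced_words_def)

lemma reduced_words_Cons:
  "(i, g) # w \<in> reduced_words G I K \<longleftrightarrow>
     i \<in> I \<and> g \<in> K i \<and> g \<noteq> \<one>\<^bsub>G\<^esub> \<and> w \<in> reduced_words G I K \<and> (w \<noteq> [] \<longrightarrow> fst (hd w) \<noteq> i)"
proof -
  have "(\<forall>n. Suc n < length ((i, g) # w) \<longrightarrow> fst (((i, g) # w) ! n) \<noteq> fst (((i, g) # w) ! Suc n))
    \<longleftrightarrow> (w \<noteq> [] \<longrightarrow> fst (hd w) \<noteq> i) \<and> (\<forall>n. Suc n < length w \<longrightarrow> fst (w ! n) \<noteq> fst (w ! Suc n))"
    (is "?l \<longleftrightarrow> ?r")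
  proof
    assume l: ?l
    show ?r
      using l[rule_format, of 0] l[rule_format, of "Suc n" for n] by (auto simp: hd_conv_nth)
  next
    assume r: ?r
    show ?l
    proof (intro allI impI)
      fix n assume "Suc n < length ((i, g) # w)"
      then show "fst (((i, g) # w) ! n) \<noteq> fst (((i, g) # w) ! Suc n)"
        using r by (cases n) (auto simp: hd_conv_nth)
    qed
  qed
  then show ?thesis
    unfolding reduced_words_def by auto
qed

context group
begin

lemma conj_eq_one_iff:
  assumes "a \<in> carrier G" "h \<in> carrier G"
  shows "a \<otimes> h \<otimes> inv a = \<one> \<longleftrightarrow> h = \<one>"
proof
  assume "a \<otimes> h \<otimes> inv a = \<one>"
  then have "(a \<otimes> h \<otimes> inv a) \<otimes> a = a"
    using assms by simp
  then show "h = \<one>"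
    using assms by (simp add: m_assoc)
qed (use assms in simp)

section \<open>Reduced words over a family of subgroups\<close>

context
  fixes I :: "'i set" and K :: "'i \<Rightarrow> 'a set"
  assumes K: "\<And>i. i \<in> I \<Longrightarrow> subgroup (K i) G"
begin

lemma factor_closed: "i \<in> I \<Longrightarrow> g \<in> K i \<Longrightarrow> g \<in> carrier G"
  by (rule subgroup.mem_carrier[OF K])

lemma factor_inv_closed: "i \<in> I \<Longrightarrow> g \<in> K i \<Longrightarrow> inv g \<in> K i"
  by (rule subgroup.m_inv_closed[OF K])

lemma factor_m_closed: "i \<in> I \<Longrightarrow> g \<in> K i \<Longrightarrow> h \<in> K i \<Longrightarrow> g \<otimes> h \<in> K i"
  by (rule subgroup.m_closed[OF K])

lemma word_eval_closed: "w \<in> reduced_words G I K \<Longrightarrow> word_eval G w \<in> carrier G"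
proof (induction w)
  case (Cons x w)
  obtain i g where x: "x = (i, g)" by force
  then have "g \<in> carrier G"
    using Cons.prems factor_closed[of i g] by (simp add: reduced_words_Cons)
  then show ?case
    using Cons by (simp add: x reduced_words_Cons)
qed simp

lemma word_eval_in_generate:
  "w \<in> reduced_words G I K \<Longrightarrow> word_eval G w \<in> generate G (\<Union>i\<in>I. K i)"
proof (induction w)
  case (Cons x w)
  then show ?case
    by (cases x) (auto simp: reduced_words_Cons intro!: generate.eng intro: generate.incl)
qed (simp add: generate.one)

lemma push_letter_reduced:
  assumes "i \<in> I" "g \<in> K i" "g \<noteq> \<one>" "w \<in> reduced_words G I K"
  shows "push_letter G (i, g) w \<in> reduced_words G I K"
    and "word_eval G (push_letter G (i, g) w) = g \<otimes> word_eval G w"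
proof -
  have gc: "g \<in> carrier G"
    using factor_closed[OF assms(1,2)] .
  show "push_letter G (i, g) w \<in> reduced_words G I K"
  proof (cases w)
    case (Cons a v)
    obtain j h where a: "a = (j, h)" by force
    then show ?thesis
      using assms Cons by (auto simp: reduced_words_Cons factor_m_closed)
  qed (use assms in \<open>auto simp: reduced_words_Cons\<close>)
  show "word_eval G (push_letter G (i, g) w) = g \<otimes> word_eval G w"
  proof (cases w)
    case (Cons a v)
    obtain j h where a: "a = (j, h)" by force
    have h: "h \<in> carrier G" "word_eval G v \<in> carrier G"
      using assms(4) factor_closed[of j h] by (simp_all add: Cons a reduced_words_Cons word_eval_closed)
    then have "g \<otimes> (h \<otimes> word_eval G v) = (g \<otimes> h) \<otimes> word_eval G v"
      using gc by (simp add: m_assoc)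
    then show ?thesis
      using h gc by (auto simp: Cons a)
  qed simp
qed

lemma word_mult_reduced:
  assumes "v \<in> reduced_words G I K" "w \<in> reduced_words G I K"
  shows "word_mult G v w \<in> reduced_words G I K \<and>
    word_eval G (word_mult G v w) = word_eval G v \<otimes> word_eval G w"
  using assms(1)
proof (induction v)
  case Nil
  then show ?case
    using assms(2) word_eval_closed by (simp add: word_mult_def)
next
  case (Cons a v)
  obtain i g where a: "a = (i, g)" by force
  have v: "i \<in> I" "g \<in> K i" "g \<noteq> \<one>" "v \<in> reduced_words G I K"
    using Cons.prems by (auto simp: a reduced_words_Cons)
  have "g \<in> carrier G"
    using factor_closed[OF v(1,2)] .
  moreover have "word_mult G (a # v) w = push_letter G (i, g) (word_mult G v w)"
    by (simp add: word_mult_def a)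
  ultimately show ?case
    using push_letter_reduced[OF v(1-3)] Cons.IH[OF v(4)] word_eval_closed[OF v(4)]
      word_eval_closed[OF assms(2)] by (simp add: a m_assoc)
qed

lemma generate_subset_word_eval:
  assumes "g \<in> generate G (\<Union>i\<in>I. K i)"
  shows "\<exists>w\<in>reduced_words G I K. word_eval G w = g"
  using assms
proof (induction rule: generate.induct)
  case one
  show ?case by (rule bexI[of _ "[]"]) auto
next
  case (incl h)
  then obtain i where i: "i \<in> I" "h \<in> K i" by blast
  then have "h \<in> carrier G" by (rule factor_closed)
  then show ?case
    using i by (intro bexI[of _ "if h = \<one> then [] else [(i, h)]"]) (auto simp: reduced_words_Cons)
next
  case (inv h)
  then obtain i where i: "i \<in> I" "inv h \<in> K i" using factor_inv_closed by fast
  then have "inv h \<in> carrier G" by (rule factor_closed)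
  then show ?case
    using i by (intro bexI[of _ "if inv h = \<one> then [] else [(i, inv h)]"]) (auto simp: reduced_words_Cons)
next
  case (eng h1 h2)
  then show ?case using word_mult_reduced by metis
qed

text \<open>The word \<open>u\<close> is \<open>v\<close> reversed with inverted letters, followed
  by \<open>w\<close>. The induction moves the letters of \<open>v\<close> one by one to the front
  of \<open>w\<close>; the condition on the heads keeps the junction reduced.\<close>

lemma reduced_inverse_append:
  assumes "v \<in> reduced_words G I K" "w \<in> reduced_words G I K"
    and "v \<noteq> [] \<Longrightarrow> w \<noteq> [] \<Longrightarrow> fst (hd v) \<noteq> fst (hd w)"
  shows "\<exists>u\<in>reduced_words G I K. length u = length v + length w \<and>
    word_eval G u = inv (word_eval G v) \<otimes> word_eval G w"
  using assms
proof (induction v arbitrary: w)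
  case Nil
  then show ?case using word_eval_closed by (auto intro!: bexI[of _ w])
next
  case (Cons a v)
  obtain i g where a: "a = (i, g)" by force
  have v: "i \<in> I" "g \<in> K i" "g \<noteq> \<one>" "v \<in> reduced_words G I K" "v \<noteq> [] \<longrightarrow> fst (hd v) \<noteq> i"
    using Cons.prems(1) by (auto simp: a reduced_words_Cons)
  have g: "g \<in> carrier G"
    using factor_closed[OF v(1,2)] .
  have w': "(i, inv g) # w \<in> reduced_words G I K"
    using v Cons.prems g factor_inv_closed[OF v(1,2)] by (auto simp: reduced_words_Cons a)
  obtain u where u: "u \<in> reduced_words G I K" "length u = length v + length ((i, inv g) # w)"
    "word_eval G u = inv (word_eval G v) \<otimes> word_eval G ((i, inv g) # w)"
    using Cons.IH[OF v(4) w'] v(5) by auto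
  have "word_eval G u = inv (word_eval G (a # v)) \<otimes> word_eval G w"
    using g word_eval_closed[OF v(4)] word_eval_closed[OF Cons.prems(2)]
    by (simp add: u(3) a m_assoc inv_mult_group)
  then show ?case using u by auto
qed

text \<open>A trivial kernel gives injectivity without group laws for \<open>word_mult\<close>: if
  the heads differ in index, the inverse of \<open>v\<close> times \<open>w\<close> is the value of
  a reduced word of full length; otherwise a shorter pair arises.\<close>

lemma word_eval_inj:
  assumes nontriv: "\<And>w. w \<in> reduced_words G I K \<Longrightarrow> w \<noteq> [] \<Longrightarrow> word_eval G w \<noteq> \<one>"
    and "v \<in> reduced_words G I K" "w \<in> reduced_words G I K" "word_eval G v = word_eval G w"
  shows "v = w"
  using assms(2-)
proof (induction "length v + length w" arbitrary: v w rule: less_induct)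
  case less
  show ?case
  proof (cases "v = [] \<or> w = [] \<or> fst (hd v) \<noteq> fst (hd w)")
    case True
    then obtain u where "u \<in> reduced_words G I K" "length u = length v + length w"
      "word_eval G u = inv (word_eval G v) \<otimes> word_eval G w"
      using reduced_inverse_append[OF less.prems(1,2)] by blast
    then show ?thesis
      using nontriv[of u] less.prems(3) word_eval_closed[OF less.prems(2)] by (cases "u = []") auto
  next
    case False
    then obtain i g v' h w' where vw: "v = (i, g) # v'" "w = (i, h) # w'"
      by (cases v; cases w) auto
    have v: "i \<in> I" "g \<in> K i" "v' \<in> reduced_words G I K" "v' \<noteq> [] \<longrightarrow> fst (hd v') \<noteq> i"
      and w: "h \<in> K i" "w' \<in> reduced_words G I K" "w' \<noteq> [] \<longrightarrow> fst (hd w') \<noteq> i"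
      using less.prems(1,2) unfolding vw reduced_words_Cons by auto
    have c: "g \<in> carrier G" "h \<in> carrier G" "word_eval G v' \<in> carrier G" "word_eval G w' \<in> carrier G"
      using v w by (simp_all add: factor_closed[OF v(1)] word_eval_closed)
    have e: "g \<otimes> word_eval G v' = h \<otimes> word_eval G w'"
      using less.prems(3) vw by simp
    show ?thesis
    proof (cases "g = h")
      case True
      then have "word_eval G v' = word_eval G w'"
        using e c by simp
      then show ?thesis
        using less.hyps[of v' w'] v w by (simp add: vw True)
    next
      case False
      \<comment> \<open>With \<open>h\<close> absorbed into the first letter of \<open>v\<close>,
        the pair \<open>?x\<close>, \<open>w'\<close> still has equal values, and its total length
        is one less. But \<open>w'\<close> does not start with the index \<open>i\<close>, so
        \<open>?x = w'\<close> is absurd.\<close>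
      let ?x = "(i, inv h \<otimes> g) # v'"
      have "inv h \<otimes> g \<noteq> \<one>"
        using False c by (metis inv_equality inv_inv inv_closed)
      then have x: "?x \<in> reduced_words G I K"
        using v w by (simp add: reduced_words_Cons factor_m_closed factor_inv_closed)
      have "word_eval G ?x = inv h \<otimes> (h \<otimes> word_eval G w')"
        using c by (simp add: m_assoc flip: e)
      also have "\<dots> = word_eval G w'"
        using c by (simp flip: m_assoc)
      finally have "?x = w'"
        using less.hyps[of ?x w'] x w by (simp add: vw)
      then show ?thesis
        using w by auto
    qed
  qed
qed

text \<open>Evaluation is a bijection from reduced words onto the generated subgroup. Its inverse is
  the isomorphism, and multiplicativity is checked after evaluating.\<close>

lemma free_product_iso_generate:
  assumes "\<And>w. w \<in> reduced_words G I K \<Longrightarrow> w \<noteq> [] \<Longrightarrow> word_eval G w \<noteq> \<one>"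
  shows "G\<lparr>carrier := generate G (\<Union>i\<in>I. K i)\<rparr> \<cong> free_product G I K"
proof -
  let ?H = "G\<lparr>carrier := generate G (\<Union>i\<in>I. K i)\<rparr>" and ?R = "reduced_words G I K"
  let ?f = "inv_into ?R (word_eval G)"
  have inj: "inj_on (word_eval G) ?R"
    using word_eval_inj[OF assms] by (blast intro: inj_onI)
  have img: "word_eval G ` ?R = carrier ?H"
    using word_eval_in_generate generate_subset_word_eval by auto
  have bij: "bij_betw ?f (carrier ?H) ?R"
    using bij_betw_inv_into[of "word_eval G" ?R "carrier ?H"] inj img by (simp add: bij_betw_def)
  have "?f (x \<otimes> y) = word_mult G (?f x) (?f y)" if "x \<in> carrier ?H" "y \<in> carrier ?H" for x y
  proof -
    have r: "?f x \<in> ?R" "?f y \<in> ?R"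
      using that img by (metis inv_into_into)+
    have "word_eval G (word_mult G (?f x) (?f y)) = x \<otimes> y"
      using word_mult_reduced[OF r] that img by (simp add: f_inv_into_f)
    then show ?thesis
      using word_mult_reduced[OF r] inv_into_f_f[OF inj] by metis
  qed
  then have "?f \<in> iso ?H (free_product G I K)"
    using bij bij_betwE[OF bij] by (auto simp: iso_def hom_def free_product_def)
  then show ?thesis
    by (auto simp: is_iso_def)
qed

end

end

section \<open>Rotation actions\<close>

text \<open>The radius \<open>1\<close> of the rotation condition is relaxed to \<delta>, so that
  every constant below is a multiple of \<delta>.\<close>

locale rotation_action = group G for G :: "('g, 'm) monoid_scheme" (structure) +
  fixes \<phi> :: "'g \<Rightarrow> 'x::metric_space \<Rightarrow> 'x" and C :: "'x set" and Gc :: "'x \<Rightarrow> 'g set"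
    and \<delta> :: real
  assumes delta_ge_1: "1 \<le> \<delta>"
    and four_point: "\<And>w x y z :: 'x. min (gp w x y) (gp w y z) - \<delta> \<le> gp w x z"
    and act_one [simp]: "\<phi> \<one> x = x"
    and act_mult: "g \<in> carrier G \<Longrightarrow> h \<in> carrier G \<Longrightarrow> \<phi> (g \<otimes> h) x = \<phi> g (\<phi> h x)"
    and act_dist: "g \<in> carrier G \<Longrightarrow> dist (\<phi> g x) (\<phi> g y) = dist x y"
    and act_C: "g \<in> carrier G \<Longrightarrow> c \<in> C \<Longrightarrow> \<phi> g c \<in> C"
    and Gc_subgroup: "c \<in> C \<Longrightarrow> subgroup (Gc c) G"
    and Gc_fix: "c \<in> C \<Longrightarrow> h \<in> Gc c \<Longrightarrow> \<phi> h c = c"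
    and Gc_conj: "g \<in> carrier G \<Longrightarrow> c \<in> C \<Longrightarrow> Gc (\<phi> g c) = (\<lambda>h. g \<otimes> h \<otimes> inv g) ` Gc c"
    and sep: "c \<in> C \<Longrightarrow> c' \<in> C \<Longrightarrow> c \<noteq> c' \<Longrightarrow> 38 * \<delta> \<le> dist c c'"
    and rot: "c \<in> C \<Longrightarrow> g \<in> Gc c \<Longrightarrow> g \<noteq> \<one> \<Longrightarrow> x \<in> C \<Longrightarrow> x \<noteq> c \<Longrightarrow> gp c x (\<phi> g x) \<le> \<delta>"
begin

text \<open>The four-point inequality as a dichotomy: lying in the same direction from
  \<open>w\<close> is transitive up to a loss of \<delta>.\<close>

lemma gp_or: "gp (w::'x) x y \<le> gp w x z + \<delta> \<or> gp w y z \<le> gp w x z + \<delta>"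
  using four_point[of w x y z] by linarith

lemma Gc_carrier: "c \<in> C \<Longrightarrow> g \<in> Gc c \<Longrightarrow> g \<in> carrier G"
  using subgroup.mem_carrier[OF Gc_subgroup] .

lemma Gc_inv: "c \<in> C \<Longrightarrow> g \<in> Gc c \<Longrightarrow> inv g \<in> Gc c"
  using subgroup.m_inv_closed[OF Gc_subgroup] .

lemma Gc_conjI: "g \<in> carrier G \<Longrightarrow> c \<in> C \<Longrightarrow> h \<in> Gc c \<Longrightarrow> g \<otimes> h \<otimes> inv g \<in> Gc (\<phi> g c)"
  by (simp add: Gc_conj)

lemma act_inv [simp]:
  assumes "g \<in> carrier G"
  shows "\<phi> (inv g) (\<phi> g x) = x" "\<phi> g (\<phi> (inv g) x) = x"
  using assms act_mult[of "inv g" g x] act_mult[of g "inv g" x] by simp_all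

lemma act_inj: "g \<in> carrier G \<Longrightarrow> \<phi> g x = \<phi> g y \<longleftrightarrow> x = y"
  by (metis act_inv(1))

lemma act_inv_eq_iff: "g \<in> carrier G \<Longrightarrow> \<phi> (inv g) x = y \<longleftrightarrow> x = \<phi> g y"
  using act_inv(1)[of g y] act_inv(2)[of g x] by auto

lemma gp_act: "g \<in> carrier G \<Longrightarrow> gp (\<phi> g x) (\<phi> g y) (\<phi> g z) = gp x y z"
  by (simp add: gromov_product_def act_dist)

lemma gp_act_fix: "c \<in> C \<Longrightarrow> h \<in> Gc c \<Longrightarrow> gp c (\<phi> h y) (\<phi> h z) = gp c y z"
  using gp_act[of h c y z] by (simp add: Gc_fix Gc_carrier)

lemma gp_act_inv: "g \<in> carrier G \<Longrightarrow> gp (\<phi> (inv g) x) (\<phi> (inv g) y) (\<phi> (inv g) z) = gp x y z"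
  by (rule gp_act) simp

section \<open>Groups generated by rotations, and their orbits\<close>

definition rotgrp :: "'x set \<Rightarrow> 'g set" where
  "rotgrp A = generate G (\<Union>c\<in>A. Gc c)"

definition rotorb :: "'x set \<Rightarrow> 'x set" where
  "rotorb A = {\<phi> g c | g c. g \<in> rotgrp A \<and> c \<in> A}"

text \<open>Up to a bounded error \<open>gp e a b\<close> is the distance from \<open>e\<close> to a
  geodesic from \<open>a\<close> to \<open>b\<close>, so this keeps the apices outside
  \<open>W\<close> away from the hull of \<open>W\<close>.\<close>

definition hull_closed :: "'x set \<Rightarrow> bool" where
  "hull_closed W \<longleftrightarrow> (\<forall>e\<in>C - W. \<forall>a\<in>W. \<forall>b\<in>W. 9 * \<delta> < gp e a b)"

lemma rotgrp_subgroup: "A \<subseteq> C \<Longrightarrow> subgroup (rotgrp A) G"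
  unfolding rotgrp_def by (rule generate_is_subgroup) (auto intro: Gc_carrier)

lemma rotgrp_carrier: "A \<subseteq> C \<Longrightarrow> g \<in> rotgrp A \<Longrightarrow> g \<in> carrier G"
  using subgroup.mem_carrier[OF rotgrp_subgroup] .

lemma rotgrp_mono: "A \<subseteq> B \<Longrightarrow> rotgrp A \<subseteq> rotgrp B"
  unfolding rotgrp_def by (rule mono_generate) blast

lemma Gc_rotgrp: "c \<in> A \<Longrightarrow> g \<in> Gc c \<Longrightarrow> g \<in> rotgrp A"
  unfolding rotgrp_def by (rule generate.incl) blast

lemma subset_rotorb: "A \<subseteq> rotorb A"
proof
  fix c assume "c \<in> A"
  then have "\<phi> \<one> c \<in> rotorb A"
    unfolding rotorb_def rotgrp_def using generate.one by blast
  then show "c \<in> rotorb A" by simp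
qed

lemma rotorb_subset_C: "A \<subseteq> C \<Longrightarrow> rotorb A \<subseteq> C"
  unfolding rotorb_def by (auto intro: act_C rotgrp_carrier)

lemma rotorb_mono: "A \<subseteq> B \<Longrightarrow> rotorb A \<subseteq> rotorb B"
  unfolding rotorb_def using rotgrp_mono[of A B] by blast

lemma rotorb_act:
  assumes A: "A \<subseteq> C" and g: "g \<in> rotgrp A" and z: "z \<in> rotorb A"
  shows "\<phi> g z \<in> rotorb A"
proof -
  obtain k c where k: "k \<in> rotgrp A" "c \<in> A" "z = \<phi> k c"
    using z unfolding rotorb_def by blast
  have "\<phi> g z = \<phi> (g \<otimes> k) c"
    using act_mult[OF rotgrp_carrier[OF A g] rotgrp_carrier[OF A k(1)]] by (simp add: k(3))
  moreover have "g \<otimes> k \<in> rotgrp A"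
    by (rule subgroup.m_closed[OF rotgrp_subgroup[OF A] g k(1)])
  ultimately show ?thesis
    using k unfolding rotorb_def by blast
qed

text \<open>Rotations about \<open>\<phi> k c\<close> are conjugates by \<open>k\<close> of
  rotations about \<open>c\<close>; hence one apex per orbit generates enough.\<close>

lemma rotorb_Gc_subset:
  assumes A: "A \<subseteq> C" and z: "z \<in> rotorb A"
  shows "Gc z \<subseteq> rotgrp A"
proof -
  obtain k c where k: "k \<in> rotgrp A" "c \<in> A" "z = \<phi> k c"
    using z unfolding rotorb_def by blast
  have Gcz: "Gc z = (\<lambda>h. k \<otimes> h \<otimes> inv k) ` Gc c"
    using Gc_conj[OF rotgrp_carrier[OF A k(1)]] k A by blast
  have "k \<otimes> h \<otimes> inv k \<in> rotgrp A" if "h \<in> Gc c" for h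
    using Gc_rotgrp[OF k(2) that] k(1) rotgrp_subgroup[OF A]
    by (intro subgroup.m_closed subgroup.m_inv_closed)
  then show ?thesis
    unfolding Gcz by (rule image_subsetI)
qed

end

section \<open>Windmills\<close>

text \<open>The hull of \<open>W\<close> is pictured as a subtree preserved by the group \<open>N\<close>, and \<open>L\<close> as the set of
  new apices attached to it.  By \<open>facing\<close>, every apex of \<open>L\<close> sees all of \<open>W \<union> L\<close> in one direction,
  so that its rotations throw \<open>W \<union> L\<close> off to the other side.\<close>

locale windmill = rotation_action G \<phi> C Gc \<delta>
  for G :: "('g, 'm) monoid_scheme" (structure) and \<phi> :: "'g \<Rightarrow> 'x::metric_space \<Rightarrow> 'x"
    and C Gc \<delta> +
  fixes N :: "'g set" and W L :: "'x set" and x0 :: 'x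
  assumes N_subgroup: "subgroup N G"
    and W_sub: "W \<subseteq> C" and L_sub: "L \<subseteq> C" and W_L: "W \<inter> L = {}" and x0: "x0 \<in> W"
    and W_act: "g \<in> N \<Longrightarrow> z \<in> W \<Longrightarrow> \<phi> g z \<in> W"
    and L_act: "g \<in> N \<Longrightarrow> z \<in> L \<Longrightarrow> \<phi> g z \<in> L"
    and facing: "e \<in> L \<Longrightarrow> a \<in> W \<union> L \<Longrightarrow> b \<in> W \<union> L \<Longrightarrow> a \<noteq> e \<Longrightarrow> b \<noteq> e \<Longrightarrow> 7 * \<delta> < gp e a b"
    and V_closed: "e \<in> C \<Longrightarrow> e \<notin> W \<union> L \<Longrightarrow> a \<in> W \<union> L \<Longrightarrow> b \<in> W \<union> L \<Longrightarrow> 11 * \<delta> < gp e a b"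
    and N_free: "g \<in> N \<Longrightarrow> e \<in> C \<Longrightarrow> e \<notin> W \<Longrightarrow> \<phi> g e = e \<Longrightarrow> g = \<one>"
begin

abbreviation V where "V \<equiv> W \<union> L"

lemma V_C: "z \<in> V \<Longrightarrow> z \<in> C"
  using W_sub L_sub by blast

lemma L_C: "z \<in> L \<Longrightarrow> z \<in> C"
  using L_sub by blast

lemma N_carrier: "g \<in> N \<Longrightarrow> g \<in> carrier G"
  using subgroup.mem_carrier[OF N_subgroup] .

lemma V_act: "g \<in> N \<Longrightarrow> z \<in> V \<Longrightarrow> \<phi> g z \<in> V"
  using W_act L_act by blast

lemma x0_V: "x0 \<in> V" "v \<in> L \<Longrightarrow> x0 \<noteq> v" "x0 \<in> C"
  using x0 W_L W_sub by auto

section \<open>Elements that turn at an apex and the points beyond it\<close>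

text \<open>Encodes \<open>g = h1 \<otimes> ... \<otimes> hk \<otimes> a\<close> with
  \<open>k \<ge> 1\<close>, \<open>a\<close> in \<open>N\<close> and nontrivial rotations about
  apices of \<open>L\<close>, neighbouring ones distinct and the first one \<open>v\<close>.\<close>

inductive turning :: "'x \<Rightarrow> 'g \<Rightarrow> bool" where
  turning_base: "v \<in> L \<Longrightarrow> h \<in> Gc v \<Longrightarrow> h \<noteq> \<one> \<Longrightarrow> a \<in> N \<Longrightarrow> turning v (h \<otimes> a)"
| turning_step: "v \<in> L \<Longrightarrow> h \<in> Gc v \<Longrightarrow> h \<noteq> \<one> \<Longrightarrow> u \<in> L \<Longrightarrow> u \<noteq> v \<Longrightarrow> turning u g \<Longrightarrow>
    turning v (h \<otimes> g)"

text \<open>The images of points \<open>b\<close> of \<open>V\<close> under such products of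
  rotations, with \<open>b\<close> different from the last apex: what lies behind \<open>v\<close>
  as seen from \<open>V\<close>.\<close>

inductive beyond :: "'x \<Rightarrow> 'x \<Rightarrow> bool" where
  beyond_base: "v \<in> L \<Longrightarrow> h \<in> Gc v \<Longrightarrow> h \<noteq> \<one> \<Longrightarrow> b \<in> V \<Longrightarrow> b \<noteq> v \<Longrightarrow> beyond v (\<phi> h b)"
| beyond_step: "v \<in> L \<Longrightarrow> h \<in> Gc v \<Longrightarrow> h \<noteq> \<one> \<Longrightarrow> u \<in> L \<Longrightarrow> u \<noteq> v \<Longrightarrow> beyond u z \<Longrightarrow>
    beyond v (\<phi> h z)"

lemma turning_L: "turning v g \<Longrightarrow> v \<in> L"
  by (induction rule: turning.induct)

lemma beyond_L: "beyond v z \<Longrightarrow> v \<in> L"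
  by (induction rule: beyond.induct)

lemma turning_carrier: "turning v g \<Longrightarrow> g \<in> carrier G"
  by (induction rule: turning.induct) (auto intro!: m_closed intro: Gc_carrier[OF L_C] N_carrier)

lemma beyond_C: "beyond v z \<Longrightarrow> z \<in> C"
  by (induction rule: beyond.induct) (use Gc_carrier[OF L_C] V_C act_C in blast)+

text \<open>From \<open>v\<close>, the points \<open>a\<close> and \<open>b\<close> lie in one
  direction, but \<open>b\<close> and \<open>\<phi> h b\<close> do not.\<close>

lemma rotated_facing:
  assumes v: "v \<in> L" and h: "h \<in> Gc v" "h \<noteq> \<one>" and ab: "a \<in> V" "b \<in> V" "a \<noteq> v" "b \<noteq> v"
  shows "gp v a (\<phi> h b) \<le> 2 * \<delta>"
proof -
  have "gp v b (\<phi> h b) \<le> \<delta>"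
    using rot[of v h b] v h ab V_C L_C by blast
  moreover have "7 * \<delta> < gp v b a"
    using facing v ab by blast
  ultimately show ?thesis
    using gp_or[of v b a "\<phi> h b"] delta_ge_1 by linarith
qed

text \<open>The local-to-global step: by separation, \<open>v\<close> sees \<open>z\<close> in the
  direction of \<open>u\<close>, and \<open>y\<close> in another one. An input of 6\<delta> yields
  3\<delta>, so errors do not accumulate under iteration.\<close>

lemma gp_chain:
  assumes "v \<in> C" "u \<in> C" "u \<noteq> v" and "gp u v z \<le> 6 * \<delta>" and "gp v y u \<le> 2 * \<delta>"
  shows "gp v y z \<le> 3 * \<delta>"
proof -
  have "gp v u z \<ge> 32 * \<delta>"
    using assms sep[of v u] gp_add_swap[of v u z] by auto
  then show ?thesis
    using gp_or[of v y z u] gp_commute[of v u z] assms(5) delta_ge_1 by linarith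
qed

text \<open>By induction, applied to \<open>v\<close> as a point of \<open>V\<close>, the inner apex
  \<open>u\<close> sees \<open>v\<close> and \<open>z\<close> apart. After rotating by
  \<open>h\<close>, \<open>gp_chain\<close> restores the bound 3\<delta> at
  \<open>v\<close>.\<close>

lemma beyond_gp:
  assumes "beyond v z" "y \<in> V" "y \<noteq> v"
  shows "gp v y z \<le> 3 * \<delta>"
  using assms
proof (induction arbitrary: y rule: beyond.induct)
  case (beyond_base v h b)
  then have "gp v y (\<phi> h b) \<le> 2 * \<delta>"
    using rotated_facing by blast
  then show ?case using delta_ge_1 by linarith
next
  case (beyond_step v h u z)
  note vC = L_C[OF beyond_step.hyps(1)] and uC = L_C[OF beyond_step.hyps(4)]
  have hc: "h \<in> carrier G"
    using Gc_carrier vC beyond_step.hyps by blast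
  have "gp u v z \<le> 3 * \<delta>"
    using beyond_step.IH[of v] beyond_step.hyps by blast
  then have "gp (\<phi> h u) v (\<phi> h z) \<le> 6 * \<delta>"
    using gp_act[OF hc, of u v z] Gc_fix[OF vC] beyond_step.hyps(2) delta_ge_1 by simp
  moreover have "gp v y (\<phi> h u) \<le> 2 * \<delta>"
    using rotated_facing[of v h y u] beyond_step.hyps beyond_step.prems by blast
  moreover have "\<phi> h u \<noteq> v"
    using act_inj[OF hc, of u v] Gc_fix[OF vC] beyond_step.hyps by simp
  ultimately show ?case
    using gp_chain[of v "\<phi> h u" "\<phi> h z" y] vC uC act_C hc by blast
qed

text \<open>Lets \<open>a\<close> pass a rotation about \<open>v\<close>, which becomes a rotation
  about \<open>\<phi> a v\<close>; products with factors in \<open>N\<close> are normalised this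
  way.\<close>

lemma conj_Gc:
  assumes "a \<in> carrier G" "v \<in> C" "h \<in> Gc v" "h \<noteq> \<one>"
  shows "a \<otimes> h \<otimes> inv a \<in> Gc (\<phi> a v)" "a \<otimes> h \<otimes> inv a \<noteq> \<one>"
    "\<phi> (a \<otimes> h \<otimes> inv a) (\<phi> a z) = \<phi> a (\<phi> h z)"
    "g \<in> carrier G \<Longrightarrow> (a \<otimes> h \<otimes> inv a) \<otimes> (a \<otimes> g) = a \<otimes> (h \<otimes> g)"
proof -
  have h: "h \<in> carrier G" using assms Gc_carrier by blast
  show "a \<otimes> h \<otimes> inv a \<in> Gc (\<phi> a v)"
    using Gc_conjI assms by blast
  show "a \<otimes> h \<otimes> inv a \<noteq> \<one>"
    using assms(1,4) h by (simp add: conj_eq_one_iff)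
  show "\<phi> (a \<otimes> h \<otimes> inv a) (\<phi> a z) = \<phi> a (\<phi> h z)"
    using assms(1) h by (simp add: act_mult)
  show "(a \<otimes> h \<otimes> inv a) \<otimes> (a \<otimes> g) = a \<otimes> (h \<otimes> g)" if "g \<in> carrier G"
  proof -
    have "inv a \<otimes> (a \<otimes> g) = g"
      using assms(1) that by (simp flip: m_assoc)
    then show ?thesis
      using assms(1) h that by (simp add: m_assoc)
  qed
qed

lemma turning_act:
  assumes "turning v g" and a: "a \<in> N"
  shows "turning (\<phi> a v) (a \<otimes> g)"
  using assms(1)
proof (induction rule: turning.induct)
  case (turning_base v h b)
  note c = conj_Gc[OF N_carrier[OF a] L_C[OF turning_base(1)] turning_base(2,3)]
  have "turning (\<phi> a v) ((a \<otimes> h \<otimes> inv a) \<otimes> (a \<otimes> b))"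
    using turning.turning_base[OF L_act[OF a turning_base(1)] c(1,2)] turning_base(4) a
      subgroup.m_closed[OF N_subgroup] by blast
  then show ?case using c(4) N_carrier turning_base(4) by simp
next
  case (turning_step v h u g)
  note c = conj_Gc[OF N_carrier[OF a] L_C[OF turning_step(1)] turning_step(2,3)]
  have "turning (\<phi> a v) ((a \<otimes> h \<otimes> inv a) \<otimes> (a \<otimes> g))"
    using turning.turning_step[OF L_act[OF a turning_step(1)] c(1,2) L_act[OF a turning_step(4)]]
      turning_step(5,7) act_inj[OF N_carrier[OF a]] by blast
  then show ?case using c(4) turning_carrier turning_step(6) by simp
qed

lemma beyond_act:
  assumes "beyond v z" and a: "a \<in> N"
  shows "beyond (\<phi> a v) (\<phi> a z)"
  using assms(1)
proof (induction rule: beyond.induct)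
  case (beyond_base v h b)
  note c = conj_Gc[OF N_carrier[OF a] L_C[OF beyond_base(1)] beyond_base(2,3)]
  show ?case
    using beyond.beyond_base[OF L_act[OF a beyond_base(1)] c(1,2) V_act[OF a beyond_base(4)]]
      beyond_base(5) act_inj[OF N_carrier[OF a]] c(3) by simp
next
  case (beyond_step v h u z)
  note c = conj_Gc[OF N_carrier[OF a] L_C[OF beyond_step(1)] beyond_step(2,3)]
  show ?case
    using beyond.beyond_step[OF L_act[OF a beyond_step(1)] c(1,2) L_act[OF a beyond_step(4)] _ beyond_step(7)]
      beyond_step(5) act_inj[OF N_carrier[OF a]] c(3) by simp
qed

section \<open>The enlarged group and the orbit of \<open>V\<close>\<close>

definition N2 :: "'g set" where "N2 = generate G (N \<union> (\<Union>e\<in>L. Gc e))"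

text \<open>An explicit form of the orbit of \<open>V\<close> under \<open>N2\<close> (see
  \<open>D_eq_orbit\<close>), to which the estimates for \<open>beyond\<close> apply.\<close>

definition D :: "'x set" where "D = V \<union> {z. \<exists>v. beyond v z}"

lemma N2_gens_carrier: "N \<union> (\<Union>e\<in>L. Gc e) \<subseteq> carrier G"
  using N_carrier L_C Gc_carrier by blast

lemma N2_subgroup: "subgroup N2 G"
  unfolding N2_def by (rule generate_is_subgroup[OF N2_gens_carrier])

lemma N2_carrier: "g \<in> N2 \<Longrightarrow> g \<in> carrier G"
  using subgroup.mem_carrier[OF N2_subgroup] .

lemma N_N2: "g \<in> N \<Longrightarrow> g \<in> N2"
  unfolding N2_def by (rule generate.incl) blast

lemma Gc_N2: "e \<in> L \<Longrightarrow> g \<in> Gc e \<Longrightarrow> g \<in> N2"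
  unfolding N2_def by (rule generate.incl) blast

lemma N2_induct [consumes 1, case_names N Gc mult]:
  assumes "g \<in> N2"
    and N: "\<And>a. a \<in> N \<Longrightarrow> P a"
    and Gc: "\<And>e h. e \<in> L \<Longrightarrow> h \<in> Gc e \<Longrightarrow> P h"
    and mult: "\<And>g h. g \<in> N2 \<Longrightarrow> h \<in> N2 \<Longrightarrow> P g \<Longrightarrow> P h \<Longrightarrow> P (g \<otimes> h)"
  shows "P g"
  using assms(1) unfolding N2_def
proof (induction rule: generate.induct)
  case one
  then show ?case using N subgroup.one_closed[OF N_subgroup] by blast
next
  case (incl h)
  then show ?case using N Gc by blast
next
  case (inv h)
  then show ?case using N Gc subgroup.m_inv_closed[OF N_subgroup] Gc_inv L_C by blast
next
  case (eng h1 h2)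
  then show ?case using mult unfolding N2_def by blast
qed

lemma D_C: "z \<in> D \<Longrightarrow> z \<in> C"
  unfolding D_def using V_C beyond_C by blast

text \<open>The rotation \<open>h\<close> becomes a new first factor, or merges with a first factor
  \<open>k\<close> about the same apex, which disappears if
  \<open>h \<otimes> k = \<one>\<close>.\<close>

lemma D_rotate:
  assumes e: "e \<in> L" "h \<in> Gc e" and z: "z \<in> D"
  shows "\<phi> h z \<in> D"
proof (cases "h = \<one>")
  case False
  consider "z \<in> V" | v where "beyond v z" "v \<noteq> e" | "beyond e z"
    using z unfolding D_def by blast
  then show ?thesis
  proof cases
    case 1
    then show ?thesis
      using beyond_base[OF e False, of z] Gc_fix[OF L_C[OF e(1)] e(2)] unfolding D_def by (cases "z = e") auto
  next
    case 2
    then show ?thesis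
      using beyond_step[OF e False beyond_L] unfolding D_def by blast
  next
    case 3
    then obtain k z' where k: "k \<in> Gc e" "z = \<phi> k z'"
      and z': "(z' \<in> V \<and> z' \<noteq> e) \<or> (\<exists>u\<in>L. u \<noteq> e \<and> beyond u z')"
      by (cases rule: beyond.cases) auto
    have hk: "h \<otimes> k \<in> Gc e" "\<phi> h z = \<phi> (h \<otimes> k) z'"
      using k e subgroup.m_closed[OF Gc_subgroup] L_C by (auto simp: act_mult Gc_carrier[OF L_C[OF e(1)]])
    show ?thesis
    proof (cases "h \<otimes> k = \<one>")
      case True
      then show ?thesis using hk z' unfolding D_def by auto
    next
      case False
      then have "beyond e (\<phi> h z)"
        unfolding hk(2) using z' beyond_base[OF e(1) hk(1)] beyond_step[OF e(1) hk(1)] by blast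
      then show ?thesis unfolding D_def by blast
    qed
  qed
qed (use z in simp)

lemma D_act:
  assumes "g \<in> N2" "z \<in> D"
  shows "\<phi> g z \<in> D"
  using assms
proof (induction arbitrary: z rule: N2_induct)
  case (N a)
  then show ?case unfolding D_def using V_act beyond_act by blast
next
  case (Gc e h)
  then show ?case using D_rotate by blast
next
  case (mult g h)
  then show ?case by (simp add: act_mult N2_carrier)
qed

lemma D_act_iff: "g \<in> N2 \<Longrightarrow> \<phi> g z \<in> D \<longleftrightarrow> z \<in> D"
  by (metis D_act N2_carrier N2_subgroup act_inv(1) subgroup.m_inv_closed)

lemma D_eq_orbit: "D = {\<phi> g z | g z. g \<in> N2 \<and> z \<in> V}"
proof
  have "\<exists>g y. z = \<phi> g y \<and> g \<in> N2 \<and> y \<in> V" if "beyond v z" for v z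
    using that
  proof (induction rule: beyond.induct)
    case (beyond_base v h b)
    then show ?case using Gc_N2 by blast
  next
    case (beyond_step v h u z)
    then obtain g y where g: "z = \<phi> g y" "g \<in> N2" "y \<in> V" by blast
    have h: "h \<in> N2" using beyond_step Gc_N2 by blast
    then have "\<phi> h z = \<phi> (h \<otimes> g) y"
      using g by (simp add: act_mult N2_carrier)
    then show ?case using g h subgroup.m_closed[OF N2_subgroup] by blast
  qed
  moreover have "\<exists>g y. z = \<phi> g y \<and> g \<in> N2 \<and> y \<in> V" if "z \<in> V" for z
    using that act_one subgroup.one_closed[OF N2_subgroup] by metis
  ultimately show "D \<subseteq> {\<phi> g z | g z. g \<in> N2 \<and> z \<in> V}"
    unfolding D_def by blast
  show "{\<phi> g z | g z. g \<in> N2 \<and> z \<in> V} \<subseteq> D"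
    using D_act unfolding D_def by blast
qed

section \<open>Moving an apex to the side of \<open>W\<close>\<close>

text \<open>Roughly, \<open>e\<close> lies behind no apex of \<open>L\<close>.\<close>

definition based :: "'x \<Rightarrow> bool" where
  "based e \<longleftrightarrow> (\<forall>v z. beyond v z \<longrightarrow> gp v z e \<le> 6 * \<delta>)"

text \<open>If \<open>e\<close> lies behind an apex \<open>v\<close>, the rotation at \<open>v\<close> that brings it back to the side of \<open>W\<close>
  brings it definitely closer to \<open>x0\<close>.\<close>

lemma ex_based:
  "\<exists>g\<in>N2. based (\<phi> g e)"
proof -
  let ?X = "(\<lambda>g. dist x0 (\<phi> g e)) ` N2"
  have one: "\<one> \<in> N2"
    using subgroup.one_closed[OF N2_subgroup] .
  \<comment> \<open>The infimum need not be attained; an error below 2\<delta> is harmless because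
    the rotation below gains 2\<delta>.\<close>
  have "Inf ?X < Inf ?X + 2 * \<delta>"
    using delta_ge_1 by simp
  then obtain g where g: "g \<in> N2" "dist x0 (\<phi> g e) < Inf ?X + 2 * \<delta>"
    using cInf_lessD[of ?X "Inf ?X + 2 * \<delta>"] one by blast
  have "bdd_below ?X"
    by (rule bdd_belowI[of _ 0]) auto
  then have min: "dist x0 (\<phi> g e) < dist x0 (\<phi> k e) + 2 * \<delta>" if "k \<in> N2" for k
    using g(2) cInf_lower[of "dist x0 (\<phi> k e)" ?X] that by fastforce
  have "gp v z (\<phi> g e) \<le> 6 * \<delta>" if b: "beyond v z" for v z
  proof (rule ccontr)
    let ?e = "\<phi> g e"
    assume "\<not> ?thesis"
    then have big: "6 * \<delta> < gp v z ?e" by simp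
    have vL: "v \<in> L" and vC: "v \<in> C"
      using beyond_L[OF b] L_C by auto
    have xv: "x0 \<noteq> v"
      using x0_V vL by blast
    have "gp v x0 z \<le> 3 * \<delta>"
      using beyond_gp[OF b] x0_V vL by blast
    then have far: "gp v x0 ?e \<le> 4 * \<delta>"
      using gp_or[of v x0 ?e z] gp_commute[of v z ?e] big delta_ge_1 by linarith
    obtain h z' where h: "h \<in> Gc v" "z = \<phi> h z'"
      and z': "(z' \<in> V \<and> z' \<noteq> v) \<or> (\<exists>u\<in>L. u \<noteq> v \<and> beyond u z')"
      using b by (cases rule: beyond.cases) auto
    have hc: "h \<in> carrier G" using Gc_carrier vC h by blast
    \<comment> \<open>Undoing \<open>h\<close> turns \<open>z\<close> into \<open>z'\<close>, which
      \<open>v\<close> sees in the direction of \<open>x0\<close>: by \<open>facing\<close> alone,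
      or through the next apex \<open>u\<close>.\<close>
    have near: "6 * \<delta> \<le> gp v x0 z'"
      using z'
    proof
      assume "z' \<in> V \<and> z' \<noteq> v"
      then have "7 * \<delta> < gp v x0 z'"
        using facing[OF vL x0_V(1)] xv by blast
      then show ?thesis using delta_ge_1 by linarith
    next
      assume "\<exists>u\<in>L. u \<noteq> v \<and> beyond u z'"
      then obtain u where u: "u \<in> L" "u \<noteq> v" "beyond u z'" by blast
      have "gp u v z' \<le> 3 * \<delta>"
        using beyond_gp[OF u(3)] vL u(2) by blast
      then have "35 * \<delta> \<le> gp v u z'"
        using sep[of v u] vC L_C[OF u(1)] u(2) gp_add_swap[of v u z'] by auto
      moreover have "7 * \<delta> < gp v x0 u"
        using facing[OF vL x0_V(1)] xv u by blast
      ultimately show ?thesis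
        using gp_or[of v x0 u z'] delta_ge_1 by linarith
    qed
    let ?f = "\<phi> (inv h) ?e"
    have "gp v z' ?f = gp v z ?e"
      using gp_act_fix[OF vC Gc_inv[OF vC h(1)], of z ?e] h(2) hc by simp
    then have "5 * \<delta> \<le> gp v x0 ?f"
      using near big gp_or[of v x0 z' ?f] by linarith
    moreover have "dist v ?f = dist v ?e"
      using act_dist[of "inv h" v ?e] hc Gc_fix[OF vC Gc_inv[OF vC h(1)]] by simp
    \<comment> \<open>The distance to \<open>v\<close> is unchanged, and the product with
      \<open>x0\<close> grows from at most 4\<delta> to at least 5\<delta>.\<close>
    ultimately have "dist x0 ?f + 2 * \<delta> \<le> dist x0 ?e"
      using far by (simp add: gromov_product_def field_simps)
    moreover have "inv h \<otimes> g \<in> N2"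
      using g(1) Gc_N2[OF vL Gc_inv[OF vC h(1)]] subgroup.m_closed[OF N2_subgroup] by blast
    moreover have "?f = \<phi> (inv h \<otimes> g) e"
      using hc g(1) by (simp add: act_mult N2_carrier)
    ultimately show False
      using min by force
  qed
  then show ?thesis
    using g(1) unfolding based_def by blast
qed

text \<open>Once \<open>e\<close> is moved to a based apex, it sees each point of \<open>D\<close>
  in the direction of a point of \<open>V\<close>, and \<open>V_closed\<close> applies.\<close>

lemma D_hull_closed: "hull_closed D"
  unfolding hull_closed_def
proof (intro ballI)
  fix e d d' assume e: "e \<in> C - D" and d: "d \<in> D" "d' \<in> D"
  obtain g where g: "g \<in> N2" "based (\<phi> g e)"
    using ex_based by blast
  let ?e = "\<phi> g e"
  have eC: "?e \<in> C" and eD: "?e \<notin> D"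
    using e g(1) act_C N2_carrier D_act_iff by auto
  \<comment> \<open>The point \<open>q\<close> is \<open>y\<close> itself or the apex that
    \<open>y\<close> lies beyond; 32\<delta> is the separation 38\<delta> less the 6\<delta> from
    \<open>based\<close>.\<close>
  have proj: "\<exists>q\<in>V. 32 * \<delta> \<le> gp ?e q y" if y: "y \<in> D" for y
  proof (cases "y \<in> V")
    case True
    have "gp ?e y y \<ge> 38 * \<delta>"
      using sep[of ?e y] eC D_C[OF y] y eD by (auto simp: gp_self)
    then have "32 * \<delta> \<le> gp ?e y y"
      using delta_ge_1 by linarith
    then show ?thesis using True by blast
  next
    case False
    then obtain v where v: "beyond v y" using y unfolding D_def by blast
    then have vV: "v \<in> L" using beyond_L by blast
    have "gp v ?e y \<le> 6 * \<delta>"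
      using g(2) v gp_commute[of v ?e y] unfolding based_def by simp
    moreover have "?e \<noteq> v"
      using vV eD unfolding D_def by blast
    ultimately have "32 * \<delta> \<le> gp ?e v y"
      using sep[of ?e v] eC L_C[OF vV] gp_add_swap[of ?e v y] by auto
    then show ?thesis using vV by blast
  qed
  obtain q where q: "q \<in> V" "32 * \<delta> \<le> gp ?e q (\<phi> g d)"
    using proj[of "\<phi> g d"] D_act g(1) d by blast
  obtain q' where q': "q' \<in> V" "32 * \<delta> \<le> gp ?e q' (\<phi> g d')"
    using proj[of "\<phi> g d'"] D_act g(1) d by blast
  have "?e \<notin> V" using eD unfolding D_def by blast
  then have "11 * \<delta> < gp ?e q q'"
    using V_closed[OF eC _ q(1) q'(1)] by blast
  \<comment> \<open>Replacing \<open>q'\<close> and then \<open>q\<close> by points of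
    \<open>D\<close> costs \<delta> each, from 11\<delta> down to 9\<delta>.\<close>
  then have "10 * \<delta> < gp ?e q (\<phi> g d')"
    using gp_or[of ?e q q' "\<phi> g d'"] q'(2) delta_ge_1 by linarith
  then have "9 * \<delta> < gp ?e (\<phi> g d) (\<phi> g d')"
    using gp_or[of ?e "\<phi> g d" q "\<phi> g d'"] q(2) gp_commute[of ?e q "\<phi> g d"] delta_ge_1 by linarith
  then show "9 * \<delta> < gp e d d'"
    using gp_act[OF N2_carrier[OF g(1)]] by simp
qed

lemma based_act:
  assumes "based e" "a \<in> N"
  shows "based (\<phi> a e)"
  unfolding based_def
proof (intro allI impI)
  fix v z assume "beyond v z"
  then have "beyond (\<phi> (inv a) v) (\<phi> (inv a) z)"
    using beyond_act assms(2) subgroup.m_inv_closed[OF N_subgroup] by blast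
  then have "gp (\<phi> (inv a) v) (\<phi> (inv a) z) e \<le> 6 * \<delta>"
    using assms(1) unfolding based_def by blast
  then show "gp v z (\<phi> a e) \<le> 6 * \<delta>"
    using gp_act_inv[OF N_carrier[OF assms(2)], of v z "\<phi> a e"] N_carrier[OF assms(2)] by simp
qed

section \<open>Freeness of the enlarged group outside \<open>D\<close>\<close>

text \<open>The counterpart of \<open>beyond_gp\<close> for based points. In the base case the
  rotation is shifted to \<open>y\<close>, as \<open>\<phi> (inv h) y\<close> is beyond
  \<open>v\<close> and \<open>\<phi> a e\<close> is based; the bound 6\<delta> is just what
  \<open>gp_chain\<close> accepts.\<close>

lemma turning_gp:
  assumes "turning v g" "based e" "y \<in> V" "y \<noteq> v"
  shows "gp v y (\<phi> g e) \<le> 6 * \<delta>"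
  using assms
proof (induction arbitrary: y rule: turning.induct)
  case (turning_base v h a)
  note vC = L_C[OF turning_base.hyps(1)]
  have hc: "h \<in> carrier G" using Gc_carrier vC turning_base by blast
  have "inv h \<noteq> \<one>" using turning_base.hyps(3) hc by simp
  then have "beyond v (\<phi> (inv h) y)"
    using beyond_base[of v "inv h" y] turning_base Gc_inv[OF vC] by blast
  then have "gp v (\<phi> (inv h) y) (\<phi> a e) \<le> 6 * \<delta>"
    using based_act turning_base unfolding based_def by blast
  then show ?case
    using gp_act_fix[OF vC turning_base.hyps(2), of "\<phi> (inv h) y" "\<phi> a e"] hc
      N_carrier[OF turning_base.hyps(4)] by (simp add: act_mult)
next
  case (turning_step v h u g)
  note vC = L_C[OF turning_step.hyps(1)] and uC = L_C[OF turning_step.hyps(4)]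
  have hc: "h \<in> carrier G"
    using Gc_carrier vC turning_step.hyps by blast
  have "gp u v (\<phi> g e) \<le> 6 * \<delta>"
    using turning_step.IH[of v] turning_step.hyps turning_step.prems by blast
  then have "gp (\<phi> h u) v (\<phi> h (\<phi> g e)) \<le> 6 * \<delta>"
    using gp_act[OF hc, of u v "\<phi> g e"] Gc_fix[OF vC] turning_step.hyps(2) by simp
  moreover have "gp v y (\<phi> h u) \<le> 2 * \<delta>"
    using rotated_facing[of v h y u] turning_step.hyps turning_step.prems by blast
  moreover have "\<phi> h u \<noteq> v"
    using act_inj[OF hc, of u v] Gc_fix[OF vC] turning_step.hyps by simp
  ultimately have "gp v y (\<phi> h (\<phi> g e)) \<le> 3 * \<delta>"
    using gp_chain[of v "\<phi> h u" "\<phi> h (\<phi> g e)" y] vC uC act_C hc by blast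
  then show ?case
    using hc turning_carrier turning_step.hyps(6) delta_ge_1 by (simp add: act_mult)
qed

lemma turning_moves_x0: "turning v g \<Longrightarrow> beyond v (\<phi> g x0)"
proof (induction rule: turning.induct)
  case (turning_base v h a)
  have "\<phi> a x0 \<in> V" "\<phi> a x0 \<noteq> v"
    using W_act[OF turning_base(4) x0] W_L turning_base(1) by auto
  moreover have "\<phi> (h \<otimes> a) x0 = \<phi> h (\<phi> a x0)"
    using turning_base Gc_carrier L_C N_carrier act_mult by metis
  ultimately show ?case
    using beyond_base turning_base by simp
next
  case (turning_step v h u g)
  have "\<phi> (h \<otimes> g) x0 = \<phi> h (\<phi> g x0)"
    using turning_step Gc_carrier L_C turning_carrier act_mult by metis
  then show ?case
    using beyond_step turning_step by simp
qed

text \<open>Otherwise \<open>x0\<close> would lie beyond \<open>v\<close>, but its product with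
  itself at \<open>v\<close> is the full distance.\<close>

lemma turning_neq_one:
  assumes "turning v g"
  shows "g \<noteq> \<one>"
proof
  assume "g = \<one>"
  then have "beyond v x0"
    using turning_moves_x0[OF assms] by simp
  then have "gp v x0 x0 \<le> 3 * \<delta>"
    using beyond_gp x0_V beyond_L by blast
  moreover have "38 * \<delta> \<le> dist v x0"
    using sep[of v x0] L_C turning_L[OF assms] x0_V by blast
  ultimately show False
    using delta_ge_1 by (simp add: gp_self)
qed

text \<open>\<open>N\<close> together with the turning elements is stable under left multiplication
  by \<open>N2\<close>, and contains \<one>.\<close>

lemma N2_cases:
  assumes "g \<in> N2"
  shows "g \<in> N \<or> (\<exists>v. turning v g)"
proof -
  let ?T = "N \<union> {g. \<exists>v. turning v g}"
  have T: "x \<in> carrier G" if "x \<in> ?T" for x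
    using that N_carrier turning_carrier by blast
  have "g \<otimes> x \<in> ?T" if "x \<in> ?T" for x
    using assms that
  proof (induction arbitrary: x rule: N2_induct)
    case (N a)
    then show ?case using turning_act subgroup.m_closed[OF N_subgroup] by blast
  next
    case (Gc e h)
    show ?case
    proof (cases "h = \<one>")
      case True
      then show ?thesis using Gc.prems T[OF Gc.prems] by simp
    next
      case False
      consider "x \<in> N" | v where "turning v x" "v \<noteq> e" | "turning e x"
        using Gc.prems by blast
      then show ?thesis
      proof cases
        case 1
        then show ?thesis using turning_base[OF Gc.hyps False] by blast
      next
        case 2
        then show ?thesis using turning_step[OF Gc.hyps False turning_L] by blast
      next
        case 3
        then obtain k y where k: "k \<in> Gc e" "x = k \<otimes> y"
          and y: "y \<in> N \<or> (\<exists>u\<in>L. u \<noteq> e \<and> turning u y)"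
          by (cases rule: turning.cases) auto
        have yc: "y \<in> carrier G" using y N_carrier turning_carrier by blast
        have hk: "h \<otimes> k \<in> Gc e" "h \<otimes> x = (h \<otimes> k) \<otimes> y"
          using k Gc.hyps subgroup.m_closed[OF Gc_subgroup] yc L_C
          by (auto simp: m_assoc Gc_carrier[OF L_C[OF Gc.hyps(1)]])
        show ?thesis
        proof (cases "h \<otimes> k = \<one>")
          case True
          then show ?thesis using hk y yc by auto
        next
          case False
          then have "turning e (h \<otimes> x)"
            unfolding hk(2) using y turning_base[OF Gc.hyps(1) hk(1)] turning_step[OF Gc.hyps(1) hk(1)]
            by blast
          then show ?thesis by blast
        qed
      qed
    qed
  next
    case (mult g h)
    have "(g \<otimes> h) \<otimes> x = g \<otimes> (h \<otimes> x)"
      by (rule m_assoc[OF N2_carrier[OF mult.hyps(1)] N2_carrier[OF mult.hyps(2)] T[OF mult.prems]])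
    then show ?case using mult.IH mult.prems by simp
  qed
  from this[of \<one>] show ?thesis
    using subgroup.one_closed[OF N_subgroup] N2_carrier[OF assms] by simp
qed

text \<open>A turning element fixing a based point \<open>e\<close> yields two apices \<open>v\<close>, \<open>w\<close> each of which
  separates \<open>e\<close> from the other.\<close>

lemma turning_no_fixpoint:
  assumes t: "turning v g" and b: "based e" and e: "e \<in> C" "e \<notin> D"
  shows "\<phi> g e \<noteq> e"
proof
  assume fixed: "\<phi> g e = e"
  \<comment> \<open>The two products add up to \<open>dist u w\<close>, which would be at most
    12\<delta>.\<close>
  have contra: False if w: "w \<in> C" "w \<noteq> u" "u \<in> C" "gp u w e \<le> 6 * \<delta>" "gp w u e \<le> 6 * \<delta>" for u w
    using sep[of u w] w gp_add_swap[of u w e] delta_ge_1 by auto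
  from t show False
  proof cases
    case (turning_base h a)
    note vC = L_C[OF turning_base(2)]
    have hc: "h \<in> carrier G" and ac: "a \<in> carrier G"
      using Gc_carrier vC turning_base N_carrier by blast+
    have hv: "\<phi> h v = v" using Gc_fix vC turning_base by blast
    show False
    proof (cases "\<phi> a v = v")
      case True
      then have "a = \<one>"
        using N_free[OF turning_base(5) vC] turning_base(2) W_L by blast
      then have "\<phi> h e = e" using fixed turning_base hc by simp
      moreover have "e \<noteq> v" using e turning_base(2) unfolding D_def by blast
      ultimately have "dist v e \<le> \<delta>" "38 * \<delta> \<le> dist v e"
        using rot[OF vC turning_base(3,4) e(1)] sep[OF vC e(1)] by (auto simp: gp_self)
      then show False using delta_ge_1 by linarith
    next
      case False
      \<comment> \<open>Here \<open>?w\<close> is \<open>\<phi> g v\<close>, and \<open>g\<close>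
        takes \<open>\<phi> (inv a) v\<close> to \<open>v\<close>. As \<open>g\<close> fixes
        \<open>e\<close>, the product at \<open>?w\<close> is a translate of one at
        \<open>v\<close>.\<close>
      let ?w = "\<phi> h (\<phi> a v)"
      have aV: "\<phi> a v \<in> V" "\<phi> (inv a) v \<in> V"
        using V_act turning_base subgroup.m_inv_closed[OF N_subgroup] by blast+
      have "beyond v ?w"
        using beyond_base turning_base aV False by blast
      then have 1: "gp v ?w e \<le> 6 * \<delta>"
        using b unfolding based_def by blast
      have "\<phi> (inv a) v \<noteq> v"
        using False act_inv_eq_iff[OF ac] by metis
      then have "gp v (\<phi> (inv a) v) e \<le> 6 * \<delta>"
        using turning_gp[OF t b aV(2)] fixed by simp
      moreover have "gp ?w v e = gp v (\<phi> (inv a) v) e"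
      proof -
        have "\<phi> g (\<phi> (inv a) v) = v" "\<phi> g v = ?w"
          using turning_base(1) hc ac hv by (simp_all add: act_mult)
        then show ?thesis
          using gp_act[of g v "\<phi> (inv a) v" e] fixed turning_carrier[OF t] by simp
      qed
      moreover have "?w \<noteq> v"
        using False act_inj[OF hc, of "\<phi> a v" v] hv by simp
      ultimately show False
        using contra[of ?w v] 1 vC act_C hc ac by simp
    qed
  next
    case (turning_step h u g')
    note vC = L_C[OF turning_step(2)] and uC = L_C[OF turning_step(5)]
    have hc: "h \<in> carrier G" using Gc_carrier vC turning_step by blast
    have hv: "\<phi> h v = v" using Gc_fix vC turning_step by blast
    \<comment> \<open>With at least two rotations, the second apex is where the next turn takes
      place, \<open>\<phi> h u\<close>.\<close>
    have "beyond v (\<phi> h u)"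
      using beyond_base turning_step by blast
    then have 1: "gp v (\<phi> h u) e \<le> 6 * \<delta>"
      using b unfolding based_def by blast
    have "gp u v (\<phi> g' e) \<le> 6 * \<delta>"
      using turning_gp[OF turning_step(7) b] turning_step by blast
    moreover have "\<phi> h (\<phi> g' e) = e"
      using fixed turning_step(1) hc turning_carrier[OF turning_step(7)] by (simp add: act_mult)
    ultimately have 2: "gp (\<phi> h u) v e \<le> 6 * \<delta>"
      using gp_act[OF hc, of u v "\<phi> g' e"] hv by simp
    have "\<phi> h u \<noteq> v"
      using act_inj[OF hc, of u v] hv turning_step by simp
    then show False
      using contra[of "\<phi> h u" v] 1 2 vC act_C hc uC by simp
  qed
qed

text \<open>Conjugation moves \<open>e\<close> to a based apex, which no turning element fixes; for
  elements of \<open>N\<close> freeness is assumed.\<close>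

lemma N2_free:
  assumes g: "g \<in> N2" and e: "e \<in> C" "e \<notin> D" and fixed: "\<phi> g e = e"
  shows "g = \<one>"
proof -
  obtain k where k: "k \<in> N2" "based (\<phi> k e)"
    using ex_based by blast
  have kc: "k \<in> carrier G" and gc: "g \<in> carrier G" using k g N2_carrier by auto
  let ?e = "\<phi> k e" and ?g = "k \<otimes> g \<otimes> inv k"
  have e': "?e \<in> C" "?e \<notin> D"
    using e act_C kc D_act_iff k(1) by auto
  have fixed': "\<phi> ?g ?e = ?e"
    using kc gc fixed by (simp add: act_mult)
  have "?g \<in> N2"
    using k(1) g subgroup.m_closed[OF N2_subgroup] subgroup.m_inv_closed[OF N2_subgroup] by blast
  then have "?g \<in> N"
    using N2_cases turning_no_fixpoint[OF _ k(2) e'] fixed' by blast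
  then have "?g = \<one>"
    using N_free[OF _ e'(1)] e'(2) fixed' unfolding D_def by blast
  then show ?thesis
    using kc gc by (simp add: conj_eq_one_iff)
qed

text \<open>A word with a letter from \<open>S\<close> evaluates to a turning element: the prefix
  \<open>w1\<close> before the first such letter has its value in \<open>N\<close> and carries its
  apex \<open>s\<close> to the first turn.\<close>

lemma reduced_word_neq_one:
  assumes A: "A \<subseteq> W" and NA: "N = rotgrp A"
    and nontriv: "\<And>w. w \<in> reduced_words G A Gc \<Longrightarrow> w \<noteq> [] \<Longrightarrow> word_eval G w \<noteq> \<one>"
    and S: "S \<subseteq> L" and trans: "\<And>s s' a. s \<in> S \<Longrightarrow> s' \<in> S \<Longrightarrow> a \<in> N \<Longrightarrow> \<phi> a s = s' \<Longrightarrow> s = s'"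
    and w: "w \<in> reduced_words G (A \<union> S) Gc" "w \<noteq> []"
  shows "word_eval G w \<noteq> \<one>"
proof -
  have AC: "\<And>c. c \<in> A \<Longrightarrow> subgroup (Gc c) G"
    using A W_sub Gc_subgroup by blast
  have evN: "word_eval G w \<in> N" if "w \<in> reduced_words G A Gc" for w
    using word_eval_in_generate[OF AC that] by (simp add: NA rotgrp_def)
  have "w \<in> reduced_words G A Gc \<or> (\<exists>w1 s h w2. w = w1 @ (s, h) # w2 \<and> w1 \<in> reduced_words G A Gc
      \<and> s \<in> S \<and> turning (\<phi> (word_eval G w1) s) (word_eval G w))"
    using w(1)
  proof (induction w)
    case (Cons x w)
    obtain i g where x: "x = (i, g)" by force
    have i: "i \<in> A \<union> S" "g \<in> Gc i" "g \<noteq> \<one>" "w \<in> reduced_words G (A \<union> S) Gc"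
      "w \<noteq> [] \<Longrightarrow> fst (hd w) \<noteq> i"
      using Cons.prems unfolding x reduced_words_Cons by auto
    note IH = Cons.IH[OF i(4)]
    show ?case
    proof (cases "i \<in> A")
      case True
      have gN: "g \<in> N" unfolding NA using Gc_rotgrp True i(2) by blast
      from IH show ?thesis
      proof (elim disjE exE conjE)
        assume "w \<in> reduced_words G A Gc"
        then show ?thesis using i True by (simp add: x reduced_words_Cons)
      next
        fix w1 s h w2
        assume w: "w = w1 @ (s, h) # w2" "w1 \<in> reduced_words G A Gc" "s \<in> S"
          "turning (\<phi> (word_eval G w1) s) (word_eval G w)"
        have "x # w1 \<in> reduced_words G A Gc"
          using i True w(1,2) by (cases w1) (auto simp: x reduced_words_Cons)
        moreover have "turning (\<phi> (word_eval G (x # w1)) s) (word_eval G (x # w))"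
          using turning_act[OF w(4) gN] N_carrier[OF gN] N_carrier[OF evN[OF w(2)]]
          by (simp add: x act_mult)
        moreover have "x # w = (x # w1) @ (s, h) # w2"
          using w(1) by simp
        ultimately show ?thesis using w(3) by blast
      qed
    next
      case False
      then have iS: "i \<in> S" "i \<in> L" using i(1) S by auto
      have "turning i (word_eval G (x # w))"
        using IH
      proof (elim disjE exE conjE)
        assume "w \<in> reduced_words G A Gc"
        then show ?thesis
          using turning_base[OF iS(2) i(2,3)] evN by (simp add: x)
      next
        fix w1 s h w2
        assume w: "w = w1 @ (s, h) # w2" "w1 \<in> reduced_words G A Gc" "s \<in> S"
          "turning (\<phi> (word_eval G w1) s) (word_eval G w)"
        \<comment> \<open>If two successive turns coincided, then \<open>s = i\<close> as
          \<open>S\<close> meets each orbit once, and freeness would make \<open>w1\<close> empty: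
          adjacent letters with equal index.\<close>
        have "\<phi> (word_eval G w1) s \<noteq> i"
        proof
          assume eq: "\<phi> (word_eval G w1) s = i"
          then have "s = i"
            using trans[OF w(3) iS(1) evN[OF w(2)]] by blast
          moreover from this have "word_eval G w1 = \<one>"
            using N_free[OF evN[OF w(2)], of i] eq iS(2) L_C W_L by blast
          then have "w1 = []" using nontriv w(2) by blast
          ultimately show False using i(5) w(1) by simp
        qed
        then show ?thesis
          using turning_step[OF iS(2) i(2,3) turning_L[OF w(4)] _ w(4)] by (simp add: x)
      qed
      then have "x # w = [] @ (i, g) # w \<and> [] \<in> reduced_words G A Gc \<and> i \<in> S
        \<and> turning (\<phi> (word_eval G []) i) (word_eval G (x # w))"
        using iS by (simp add: x)
      then show ?thesis by blast
    qed
  qed simp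
  then show ?thesis
    using nontriv w(2) turning_neq_one by blast
qed

end

section \<open>Maximal rotation systems\<close>

context rotation_action
begin

text \<open>The last two clauses are what a windmill starts from and reproduces; nonemptiness
  supplies \<open>x0\<close>.\<close>

definition good :: "'x set \<Rightarrow> bool" where
  "good A \<longleftrightarrow> A \<subseteq> C \<and> A \<noteq> {} \<and>
     (\<forall>w\<in>reduced_words G A Gc. w \<noteq> [] \<longrightarrow> word_eval G w \<noteq> \<one>) \<and>
     hull_closed (rotorb A) \<and>
     (\<forall>g\<in>rotgrp A. \<forall>e\<in>C - rotorb A. \<phi> g e = e \<longrightarrow> g = \<one>)"

lemma good_singleton:
  assumes c: "c \<in> C"
  shows "good {c}"
proof -
  have grp: "rotgrp {c} \<subseteq> Gc c"
    unfolding rotgrp_def using generate_subgroup_incl[OF _ Gc_subgroup[OF c]] by simp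
  have "rotorb {c} \<subseteq> {c}"
    unfolding rotorb_def using grp Gc_fix[OF c] by auto
  then have orb: "rotorb {c} = {c}"
    using subset_rotorb[of "{c}"] by blast
  have words: "word_eval G w \<noteq> \<one>" if w: "w \<in> reduced_words G {c} Gc" "w \<noteq> []" for w
  proof -
    obtain i g w' where w': "w = (i, g) # w'" using w(2) by (cases w) auto
    then have "g \<in> Gc c" "g \<noteq> \<one>" "w' = []"
      using w(1) by (cases w'; auto simp: reduced_words_Cons)+
    then show ?thesis using Gc_carrier[OF c] by (simp add: w')
  qed
  have d: "38 * \<delta> \<le> dist e c" if "e \<in> C" "e \<noteq> c" for e
    using sep[OF that(1) c that(2)] .
  have "hull_closed {c}"
    unfolding hull_closed_def using d delta_ge_1 by (fastforce simp: gp_self)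
  moreover have "g = \<one>" if "g \<in> rotgrp {c}" "e \<in> C - {c}" "\<phi> g e = e" for g e
  proof (rule ccontr)
    assume "g \<noteq> \<one>"
    then have "gp c e e \<le> \<delta>"
      using rot[OF c, of g e] that grp by auto
    then show False
      using d[of e] that(2) delta_ge_1 by (simp add: gp_self dist_commute)
  qed
  ultimately show ?thesis
    unfolding good_def orb using c words by blast
qed

section \<open>The extension step\<close>

text \<open>In fact \<open>gp e a b = gp p a b - dist e p + gp e a p + gp e b p\<close>.\<close>

lemma gp_le_of_near:
  assumes p: "gp p a b \<le> R" and "gp e a p \<le> r" "gp e b p \<le> r"
  shows "gp e a (b::'x) \<le> R - dist e p + 2 * r"
  using assms by (simp add: gromov_product_def dist_commute field_simps)

text \<open>If \<open>e\<close> lies between two points of the \<open>R\<close>-neighbourhood of the hull of \<open>W\<close>, then it lies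
  close to the hull, or at least much closer than \<open>R\<close>.\<close>

lemma gp_neighbourhood:
  assumes W: "W \<subseteq> C" and e: "e \<in> C" and r: "r \<le> 11 * \<delta>"
    and near: "\<And>p. p \<in> P \<Longrightarrow> p \<in> C \<and> (p \<in> W \<or> (\<exists>a\<in>W. \<exists>b\<in>W. gp p a b \<le> R))"
    and pq: "p \<in> P" "q \<in> P" "p \<noteq> e" "q \<noteq> e" "gp e p q \<le> r"
  shows "\<exists>a\<in>W. \<exists>b\<in>W. gp e a b \<le> r + 2 * \<delta> \<or> gp e a b \<le> R - 34 * \<delta> + 2 * r"
proof (rule ccontr)
  assume "\<not> ?thesis"
  then have none: "r + 2 * \<delta> < gp e a b" "R - 34 * \<delta> + 2 * r < gp e a b" if "a \<in> W" "b \<in> W" for a b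
    using that by fastforce+
  \<comment> \<open>From \<open>e\<close>, each \<open>p\<close> lies in the direction of a point of
    \<open>W\<close>: otherwise \<open>gp_le_of_near\<close> gives at most
    \<open>R - 38 * \<delta> + 2 * (r + 2 * \<delta>)\<close>, the second excluded bound.\<close>
  have shadow: "\<exists>a\<in>W. r + 2 * \<delta> < gp e a p" if p: "p \<in> P" "p \<noteq> e" for p
  proof (cases "p \<in> W")
    case True
    have "38 * \<delta> \<le> gp e p p"
      using sep[of e p] e near[OF p(1)] p(2) by (auto simp: gp_self)
    then have "r + 2 * \<delta> < gp e p p"
      using r delta_ge_1 by linarith
    then show ?thesis using True by blast
  next
    case False
    then obtain a b where ab: "a \<in> W" "b \<in> W" "gp p a b \<le> R"
      using near[OF p(1)] by blast
    have "38 * \<delta> \<le> dist e p"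
      using sep[of e p] e near[OF p(1)] p(2) by auto
    then have "r + 2 * \<delta> < gp e a p \<or> r + 2 * \<delta> < gp e b p"
      using gp_le_of_near[OF ab(3), of e "r + 2 * \<delta>"] none(2)[OF ab(1,2)] by argo
    then show ?thesis using ab(1,2) by blast
  qed
  obtain a b where a: "a \<in> W" "r + 2 * \<delta> < gp e a p" and b: "b \<in> W" "r + 2 * \<delta> < gp e b q"
    using shadow pq by meson
  \<comment> \<open>Replacing \<open>p\<close> by \<open>a\<close> and \<open>q\<close> by
    \<open>b\<close> costs \<delta> each, giving the first excluded bound.\<close>
  have "gp e a q \<le> r + \<delta>"
    using gp_or[of e p a q] gp_commute[of e a p] a(2) pq(5) delta_ge_1 by linarith
  then have "gp e a b \<le> r + 2 * \<delta>"
    using gp_or[of e a b q] b(2) by linarith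
  then show False
    using none(1)[OF a(1) b(1)] by linarith
qed

text \<open>\<open>rep\<close> chooses from the orbit as a set, so it takes one value on each
  orbit.\<close>

lemma ex_transversal:
  assumes N: "subgroup N G" and L: "\<And>g z. g \<in> N \<Longrightarrow> z \<in> L \<Longrightarrow> \<phi> g z \<in> L"
  obtains S where "S \<subseteq> L" "\<And>z. z \<in> L \<Longrightarrow> \<exists>g\<in>N. \<exists>s\<in>S. z = \<phi> g s"
    "\<And>s s' a. s \<in> S \<Longrightarrow> s' \<in> S \<Longrightarrow> a \<in> N \<Longrightarrow> \<phi> a s = s' \<Longrightarrow> s = s'"
proof -
  define orb where "orb z = (\<lambda>g. \<phi> g z) ` N" for z
  define rep where "rep z = (SOME y. y \<in> orb z)" for z
  have Nc: "g \<in> carrier G" if "g \<in> N" for g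
    using subgroup.mem_carrier[OF N that] .
  have orb_act: "orb (\<phi> a z) \<subseteq> orb z" if "a \<in> N" for a z
  proof
    fix y assume "y \<in> orb (\<phi> a z)"
    then obtain g where g: "g \<in> N" "y = \<phi> g (\<phi> a z)"
      unfolding orb_def by blast
    then have "y = \<phi> (g \<otimes> a) z"
      using Nc that by (simp add: act_mult)
    with g(1) show "y \<in> orb z"
      unfolding orb_def using subgroup.m_closed[OF N _ that] by blast
  qed
  have orb_eq: "orb (\<phi> a z) = orb z" if "a \<in> N" for a z
    using orb_act[OF that, of z] orb_act[OF subgroup.m_inv_closed[OF N that], of "\<phi> a z"] Nc[OF that]
    by simp
  have rep: "\<exists>a\<in>N. rep z = \<phi> a z" for z
  proof -
    have "orb z \<noteq> {}"
      unfolding orb_def using subgroup.one_closed[OF N] by blast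
    then have "rep z \<in> orb z"
      unfolding rep_def using some_in_eq by blast
    then show ?thesis unfolding orb_def by blast
  qed
  show ?thesis
  proof
    show "rep ` L \<subseteq> L"
      using rep L by (metis image_subsetI)
    show "\<exists>g\<in>N. \<exists>s\<in>rep ` L. z = \<phi> g s" if z: "z \<in> L" for z
    proof -
      obtain a where a: "a \<in> N" "rep z = \<phi> a z" using rep by blast
      then have "z = \<phi> (inv a) (rep z)" using Nc by simp
      then show ?thesis using subgroup.m_inv_closed[OF N a(1)] z by blast
    qed
    show "s = s'" if s: "s \<in> rep ` L" "s' \<in> rep ` L" "a \<in> N" "\<phi> a s = s'" for s s' a
    proof -
      obtain z z' where z: "s = rep z" "s' = rep z'" using s by blast
      have "orb (rep y) = orb y" for y
        using rep[of y] orb_eq by metis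
      then have "orb z = orb z'"
        using orb_eq[OF s(3), of s] s(4) z by metis
      then show ?thesis unfolding z rep_def by simp
    qed
  qed
qed

lemma good_extend:
  assumes A: "good A" and ne: "rotorb A \<noteq> C"
  shows "\<exists>B. good B \<and> A \<subset> B"
proof -
  define W N where "W = rotorb A" and "N = rotgrp A"
  have AC: "A \<subseteq> C" and words: "\<And>w. w \<in> reduced_words G A Gc \<Longrightarrow> w \<noteq> [] \<Longrightarrow> word_eval G w \<noteq> \<one>"
    and hull: "\<And>e a b. e \<in> C \<Longrightarrow> e \<notin> W \<Longrightarrow> a \<in> W \<Longrightarrow> b \<in> W \<Longrightarrow> 9 * \<delta> < gp e a b"
    and free: "\<And>g e. g \<in> N \<Longrightarrow> e \<in> C \<Longrightarrow> e \<notin> W \<Longrightarrow> \<phi> g e = e \<Longrightarrow> g = \<one>"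
    using A unfolding good_def hull_closed_def W_def N_def by auto
  have WC: "W \<subseteq> C" and AW: "A \<subseteq> W" and N: "subgroup N G"
    unfolding W_def N_def using rotorb_subset_C[OF AC] subset_rotorb rotgrp_subgroup[OF AC] by auto
  have W_act: "\<phi> g z \<in> W" if "g \<in> N" "z \<in> W" for g z
    using rotorb_act[OF AC] that unfolding W_def N_def by blast
  have Nc: "g \<in> carrier G" if "g \<in> N" for g
    using subgroup.mem_carrier[OF N that] .
  obtain x0 where x0: "x0 \<in> W"
    using A AW unfolding good_def by blast
  obtain e1 where e1: "e1 \<in> C" "e1 \<notin> W"
    using ne WC unfolding W_def by blast
  \<comment> \<open>These products measure how far the outer apices are from the hull;
    \<open>m\<close> is minimal up to \<delta>.\<close>
  let ?X = "{gp e a b | e a b. e \<in> C \<and> e \<notin> W \<and> a \<in> W \<and> b \<in> W}"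
  have "?X \<noteq> {}" using e1 x0 by blast
  moreover have "Inf ?X < Inf ?X + \<delta>" using delta_ge_1 by simp
  ultimately obtain m where m: "m \<in> ?X" "m < Inf ?X + \<delta>"
    using cInf_lessD[of ?X "Inf ?X + \<delta>"] by blast
  have "bdd_below ?X"
    by (rule bdd_belowI[of _ 0]) (auto simp: gp_nonneg)
  then have m_min: "m < gp e a b + \<delta>" if "e \<in> C" "e \<notin> W" "a \<in> W" "b \<in> W" for e a b
    using m(2) cInf_lower[of "gp e a b" ?X] that by fastforce
  obtain e0 a0 b0 where e0: "e0 \<in> C" "e0 \<notin> W" "a0 \<in> W" "b0 \<in> W" "m = gp e0 a0 b0"
    using m(1) by blast
  \<comment> \<open>The term \<open>m\<close> puts \<open>e0\<close> into \<open>L\<close>;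
    13\<delta> is the 11\<delta> of \<open>V_closed\<close> plus the loss 2\<delta> in
    \<open>nbhd\<close>.\<close>
  define R where "R = max (13 * \<delta>) m"
  define L where "L = {e \<in> C - W. \<exists>a\<in>W. \<exists>b\<in>W. gp e a b \<le> R}"
  have e0L: "e0 \<in> L" unfolding L_def R_def using e0 by force
  have near: "p \<in> C \<and> (p \<in> W \<or> (\<exists>a\<in>W. \<exists>b\<in>W. gp p a b \<le> R))" if "p \<in> W \<union> L" for p
    using that WC unfolding L_def by blast
  have nbhd: "\<exists>a'\<in>W. \<exists>b'\<in>W. gp e a' b' \<le> r + 2 * \<delta> \<or> gp e a' b' \<le> R - 34 * \<delta> + 2 * r"
    if "e \<in> C" "r \<le> 11 * \<delta>" "a \<in> W \<union> L" "b \<in> W \<union> L" "a \<noteq> e" "b \<noteq> e" "gp e a b \<le> r" for e a b r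
    by (rule gp_neighbourhood[OF WC that(1,2) near that(3-7)])
  have L_act: "\<phi> g z \<in> L" if g: "g \<in> N" and z: "z \<in> L" for g z
  proof -
    obtain a b where ab: "a \<in> W" "b \<in> W" "gp z a b \<le> R" and zC: "z \<in> C" "z \<notin> W"
      using z unfolding L_def by blast
    have "\<phi> g z \<notin> W"
      using W_act[OF subgroup.m_inv_closed[OF N g], of "\<phi> g z"] Nc[OF g] zC by auto
    moreover have "gp (\<phi> g z) (\<phi> g a) (\<phi> g b) \<le> R"
      using ab gp_act[OF Nc[OF g]] by simp
    ultimately show ?thesis
      unfolding L_def using act_C[OF Nc[OF g] zC(1)] W_act[OF g] ab by blast
  qed
  interpret windmill G \<phi> C Gc \<delta> N W L x0
  proof (intro windmill.intro windmill_axioms.intro)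
    show "rotation_action G \<phi> C Gc \<delta>" by unfold_locales
    show "subgroup N G" "W \<subseteq> C" "x0 \<in> W" "L \<subseteq> C" "W \<inter> L = {}"
      using N WC x0 unfolding L_def by auto
    show "\<phi> g z \<in> W" if "g \<in> N" "z \<in> W" for g z using W_act that .
    show "\<phi> g z \<in> L" if "g \<in> N" "z \<in> L" for g z using L_act that .
    show "g = \<one>" if "g \<in> N" "e \<in> C" "e \<notin> W" "\<phi> g e = e" for g e using free that .
    \<comment> \<open>For \<open>r = 7 * \<delta>\<close>, \<open>nbhd\<close> gives 9\<delta>,
      excluded by \<open>hull\<close>, or \<open>R - 20 * \<delta>\<close>, excluded by
      \<open>hull\<close> if \<open>R = 13 * \<delta>\<close> and by the choice of \<open>m\<close>
      if \<open>R = m\<close>.\<close>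
    show "7 * \<delta> < gp e a b"
      if e: "e \<in> L" and ab: "a \<in> W \<union> L" "b \<in> W \<union> L" "a \<noteq> e" "b \<noteq> e" for e a b
    proof (rule ccontr)
      assume "\<not> ?thesis"
      moreover have eC: "e \<in> C" "e \<notin> W" using e unfolding L_def by auto
      ultimately obtain a' b' where a': "a' \<in> W" "b' \<in> W"
        "gp e a' b' \<le> 7 * \<delta> + 2 * \<delta> \<or> gp e a' b' \<le> R - 34 * \<delta> + 2 * (7 * \<delta>)"
        using nbhd[OF eC(1) _ ab, of "7 * \<delta>"] delta_ge_1 by (auto simp: not_less)
      then show False
        using hull[OF eC a'(1,2)] m_min[OF eC a'(1,2)] delta_ge_1 unfolding R_def by linarith
    qed
    show "11 * \<delta> < gp e a b"
      if e: "e \<in> C" "e \<notin> W \<union> L" and ab: "a \<in> W \<union> L" "b \<in> W \<union> L" for e a b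
    proof (rule ccontr)
      assume "\<not> ?thesis"
      moreover have "a \<noteq> e" "b \<noteq> e" using e ab by auto
      ultimately obtain a' b' where a': "a' \<in> W" "b' \<in> W"
        "gp e a' b' \<le> 11 * \<delta> + 2 * \<delta> \<or> gp e a' b' \<le> R - 34 * \<delta> + 2 * (11 * \<delta>)"
        using nbhd[OF e(1) _ ab, of "11 * \<delta>"] by (auto simp: not_less)
      then have "gp e a' b' \<le> R"
        using delta_ge_1 unfolding R_def by linarith
      then show False
        using e a'(1,2) unfolding L_def by blast
    qed
  qed
  obtain S where S: "S \<subseteq> L" "\<And>z. z \<in> L \<Longrightarrow> \<exists>g\<in>N. \<exists>s\<in>S. z = \<phi> g s"
    "\<And>s s' a. s \<in> S \<Longrightarrow> s' \<in> S \<Longrightarrow> a \<in> N \<Longrightarrow> \<phi> a s = s' \<Longrightarrow> s = s'"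
    using ex_transversal[OF N L_act] by blast
  define B where "B = A \<union> S"
  have BC: "B \<subseteq> C" using AC S(1) L_sub unfolding B_def by blast
  have NB: "N \<subseteq> rotgrp B" unfolding N_def B_def by (rule rotgrp_mono) simp
  have LB: "z \<in> rotorb B" if "z \<in> L" for z
    using S(2)[OF that] NB unfolding rotorb_def B_def by blast
  have "rotgrp B \<subseteq> N2"
    unfolding rotgrp_def
  proof (rule generate_subgroup_incl[OF _ N2_subgroup])
    show "(\<Union>c\<in>B. Gc c) \<subseteq> N2"
      unfolding B_def using Gc_rotgrp[of _ A] N_N2 Gc_N2 S(1) unfolding N_def by blast
  qed
  \<comment> \<open>Each apex of \<open>L\<close> is in the orbit of one in \<open>S\<close>, so its
    rotations are conjugates of those about \<open>S\<close>.\<close>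
  moreover have "N2 \<subseteq> rotgrp B"
    unfolding N2_def
  proof (rule generate_subgroup_incl[OF _ rotgrp_subgroup[OF BC]])
    show "N \<union> (\<Union>e\<in>L. Gc e) \<subseteq> rotgrp B"
      using NB rotorb_Gc_subset[OF BC LB] by blast
  qed
  ultimately have grp: "rotgrp B = N2" by blast
  have "rotorb B \<subseteq> D"
    unfolding D_eq_orbit rotorb_def grp using AW S(1) unfolding B_def by blast
  moreover have "D \<subseteq> rotorb B"
  proof
    fix z assume "z \<in> D"
    then obtain g y where g: "g \<in> N2" "y \<in> W \<union> L" "z = \<phi> g y"
      unfolding D_eq_orbit by blast
    have "y \<in> rotorb B"
      using g(2) LB rotorb_mono[of A B] unfolding W_def B_def by blast
    then show "z \<in> rotorb B"
      using rotorb_act[OF BC] g grp by simp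
  qed
  ultimately have orb: "rotorb B = D" by blast
  have "word_eval G w \<noteq> \<one>" if "w \<in> reduced_words G B Gc" "w \<noteq> []" for w
    by (rule reduced_word_neq_one[OF AW N_def words S(1) S(3) that[unfolded B_def]])
  moreover have "B \<noteq> {}" using A unfolding good_def B_def by blast
  ultimately have "good B"
    unfolding good_def orb grp using BC D_hull_closed N2_free by blast
  \<comment> \<open>\<open>S\<close> is nonempty because of \<open>e0\<close>, and disjoint from
    \<open>A\<close> because \<open>A\<close> lies in \<open>W\<close>.\<close>
  moreover have "A \<subset> B"
    using S(2)[OF e0L] S(1) AW W_L unfolding B_def by blast
  ultimately show ?thesis by blast
qed

section \<open>Unions of chains\<close>

lemma rotgrp_Union_chain:
  assumes ch: "\<And>A B. A \<in> \<A> \<Longrightarrow> B \<in> \<A> \<Longrightarrow> A \<subseteq> B \<or> B \<subseteq> A" and ne: "\<A> \<noteq> {}"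
    and sub: "\<And>A. A \<in> \<A> \<Longrightarrow> A \<subseteq> C" and g: "g \<in> rotgrp (\<Union>\<A>)"
  shows "\<exists>A\<in>\<A>. g \<in> rotgrp A"
  using g unfolding rotgrp_def[of "\<Union>\<A>"]
proof (induction rule: generate.induct)
  case one
  then show ?case using ne sub subgroup.one_closed[OF rotgrp_subgroup] by blast
next
  case (incl h)
  then show ?case using Gc_rotgrp by blast
next
  case (inv h)
  then obtain A c where c: "A \<in> \<A>" "c \<in> A" "h \<in> Gc c" by blast
  then have "inv h \<in> Gc c" using Gc_inv sub by blast
  then show ?case using c Gc_rotgrp by blast
next
  case (eng h k)
  then obtain A B where AB: "A \<in> \<A>" "h \<in> rotgrp A" "B \<in> \<A>" "k \<in> rotgrp B" by blast
  then obtain D where D: "D \<in> \<A>" "A \<subseteq> D" "B \<subseteq> D" using ch by blast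
  then have "h \<in> rotgrp D" "k \<in> rotgrp D" using AB rotgrp_mono by blast+
  then have "h \<otimes> k \<in> rotgrp D"
    by (rule subgroup.m_closed[OF rotgrp_subgroup[OF sub[OF D(1)]]])
  then show ?case using D(1) by blast
qed

text \<open>Each clause concerns finitely many letters, orbit points or group elements, all found in
  one member of the chain; an apex outside the orbit of the union is outside the orbit of every
  member.\<close>

lemma good_Union_chain:
  assumes ch: "\<And>A B. A \<in> \<A> \<Longrightarrow> B \<in> \<A> \<Longrightarrow> A \<subseteq> B \<or> B \<subseteq> A" and ne: "\<A> \<noteq> {}"
    and good: "\<And>A. A \<in> \<A> \<Longrightarrow> good A"
  shows "good (\<Union>\<A>)"
proof -
  have sub: "A \<subseteq> C" if "A \<in> \<A>" for A
    using good[OF that] unfolding good_def by blast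
  note grp = rotgrp_Union_chain[OF ch ne sub]
  have upper: "\<exists>D\<in>\<A>. A \<subseteq> D \<and> B \<subseteq> D" if "A \<in> \<A>" "B \<in> \<A>" for A B
    using ch[OF that] that by blast
  have orb: "\<exists>A\<in>\<A>. z \<in> rotorb A" if z: "z \<in> rotorb (\<Union>\<A>)" for z
  proof -
    obtain g c A where g: "g \<in> rotgrp (\<Union>\<A>)" "A \<in> \<A>" "c \<in> A" "z = \<phi> g c"
      using z unfolding rotorb_def by blast
    obtain B where B: "B \<in> \<A>" "g \<in> rotgrp B" using grp g(1) by blast
    obtain D where D: "D \<in> \<A>" "A \<subseteq> D" "B \<subseteq> D" using upper[OF g(2) B(1)] by blast
    then have "g \<in> rotgrp D" "c \<in> D" using rotgrp_mono B g by blast+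
    then show ?thesis using D(1) g(4) unfolding rotorb_def by blast
  qed
  have orb_le: "rotorb A \<subseteq> rotorb (\<Union>\<A>)" if "A \<in> \<A>" for A
    using rotorb_mono[of A "\<Union>\<A>"] that by blast
  have "word_eval G w \<noteq> \<one>" if w: "w \<in> reduced_words G (\<Union>\<A>) Gc" "w \<noteq> []" for w
  proof -
    have "fst ` set w \<subseteq> \<Union>\<A>"
      using w(1) unfolding reduced_words_def by auto
    moreover have "subset.chain UNIV \<A>"
      unfolding subset_chain_def using ch by blast
    ultimately obtain A where A: "A \<in> \<A>" "fst ` set w \<subseteq> A"
      using finite_subset_Union_chain[of "fst ` set w" \<A> UNIV] ne by blast
    have "w \<in> reduced_words G A Gc"
      using w(1) A(2) unfolding reduced_words_def by auto
    then show ?thesis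
      using good[OF A(1)] w(2) unfolding good_def by blast
  qed
  moreover have "hull_closed (rotorb (\<Union>\<A>))"
    unfolding hull_closed_def
  proof (intro ballI)
    fix e a b assume e: "e \<in> C - rotorb (\<Union>\<A>)" and ab: "a \<in> rotorb (\<Union>\<A>)" "b \<in> rotorb (\<Union>\<A>)"
    obtain A B where AB: "A \<in> \<A>" "a \<in> rotorb A" "B \<in> \<A>" "b \<in> rotorb B"
      using orb ab by meson
    obtain D where D: "D \<in> \<A>" "A \<subseteq> D" "B \<subseteq> D" using upper[OF AB(1,3)] by blast
    then have "a \<in> rotorb D" "b \<in> rotorb D" "e \<in> C - rotorb D"
      using AB e rotorb_mono orb_le[OF D(1)] by blast+
    then show "9 * \<delta> < gp e a b"
      using good[OF D(1)] unfolding good_def hull_closed_def by blast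
  qed
  moreover have "g = \<one>" if g: "g \<in> rotgrp (\<Union>\<A>)" "e \<in> C - rotorb (\<Union>\<A>)" "\<phi> g e = e" for g e
  proof -
    obtain A where A: "A \<in> \<A>" "g \<in> rotgrp A" using grp g(1) by blast
    moreover have "e \<in> C - rotorb A" using g(2) orb_le[OF A(1)] by blast
    ultimately show ?thesis using good[OF A(1)] g(3) unfolding good_def by blast
  qed
  moreover have "\<Union>\<A> \<noteq> {}"
    using ne good unfolding good_def by blast
  ultimately show ?thesis
    unfolding good_def using sub by blast
qed

section \<open>A maximal system and the normal closure\<close>

lemma ex_free_basis:
  "\<exists>A\<subseteq>C. rotorb A = C \<and> (\<forall>w\<in>reduced_words G A Gc. w \<noteq> [] \<longrightarrow> word_eval G w \<noteq> \<one>)"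
proof (cases "C = {}")
  case True
  have "w = []" if "w \<in> reduced_words G {} Gc" for w
    using that by (cases w) (auto simp: reduced_words_def)
  then show ?thesis
    using True by (auto simp: rotorb_def)
next
  case False
  then have "Collect good \<noteq> {}" using good_singleton by blast
  moreover have "\<Union>\<A> \<in> Collect good" if "\<A> \<noteq> {}" "subset.chain (Collect good) \<A>" for \<A>
    using good_Union_chain[of \<A>] that unfolding subset_chain_def by blast
  ultimately obtain A where A: "A \<in> Collect good" "\<forall>X\<in>Collect good. A \<subseteq> X \<longrightarrow> X = A"
    using subset_Zorn_nonempty[of "Collect good"] by blast
  then have "rotorb A = C" using good_extend by blast
  then show ?thesis using A(1) unfolding good_def by blast
qed

text \<open>Conjugating \<open>Gc c\<close> by \<open>g\<close> gives the rotations about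
  \<open>\<phi> g c\<close>, which are already in \<open>rotgrp A\<close> since every apex is in the
  orbit of \<open>A\<close>.\<close>

lemma rotgrp_eq_normal_closure:
  assumes A: "A \<subseteq> C" and orb: "rotorb A = C"
  shows "rotgrp A = normal_closure G (\<Union>c\<in>C. Gc c)"
proof
  let ?T = "{g \<otimes> s \<otimes> inv g | g s. g \<in> carrier G \<and> s \<in> (\<Union>c\<in>C. Gc c)}"
  have "(\<Union>c\<in>A. Gc c) \<subseteq> ?T"
  proof
    fix h assume "h \<in> (\<Union>c\<in>A. Gc c)"
    then have "h \<in> (\<Union>c\<in>C. Gc c)" "h = \<one> \<otimes> h \<otimes> inv \<one>" using A Gc_carrier by auto
    then show "h \<in> ?T" by blast
  qed
  then show "rotgrp A \<subseteq> normal_closure G (\<Union>c\<in>C. Gc c)"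
    unfolding rotgrp_def normal_closure_def by (rule mono_generate)
  have "?T \<subseteq> rotgrp A"
  proof
    fix x assume "x \<in> ?T"
    then obtain g c s where "g \<in> carrier G" "c \<in> C" "s \<in> Gc c" "x = g \<otimes> s \<otimes> inv g" by blast
    then have "x \<in> Gc (\<phi> g c)" "\<phi> g c \<in> C" using Gc_conjI act_C by auto
    then show "x \<in> rotgrp A" using rotorb_Gc_subset[OF A] orb by blast
  qed
  then show "normal_closure G (\<Union>c\<in>C. Gc c) \<subseteq> rotgrp A"
    unfolding normal_closure_def by (rule generate_subgroup_incl[OF _ rotgrp_subgroup[OF A]])
qed

lemma normal_closure_free_product:
  "\<exists>C'\<subseteq>C. G\<lparr>carrier := normal_closure G (\<Union>c\<in>C. Gc c)\<rparr> \<cong> free_product G C' Gc"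
proof -
  obtain A where A: "A \<subseteq> C" "rotorb A = C"
    "\<And>w. w \<in> reduced_words G A Gc \<Longrightarrow> w \<noteq> [] \<Longrightarrow> word_eval G w \<noteq> \<one>"
    using ex_free_basis by blast
  have "G\<lparr>carrier := generate G (\<Union>c\<in>A. Gc c)\<rparr> \<cong> free_product G A Gc"
    by (rule free_product_iso_generate) (use A Gc_subgroup in auto)
  then show ?thesis
    using A(1) rotgrp_eq_normal_closure[OF A(1,2)] unfolding rotgrp_def by auto
qed

end

theorem theorem5p1:
  fixes G :: "('g, 'b) monoid_scheme"
    and \<phi> :: "'g \<Rightarrow> 'a::metric_space \<Rightarrow> 'a"
    and C :: "'a set" and Gc :: "'a \<Rightarrow> 'g set"
    and \<delta> \<rho> :: real
  assumes "group G"
    and "isometric_action G \<phi>"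
    and "geodesic_space TYPE('a)"
    and "hyperbolic TYPE('a) \<delta>"
    and "\<delta> \<ge> 1"
    and "rotating_family G \<phi> C Gc"
    and "separated \<rho> C"
    and "fairly_rotating G \<phi> C Gc"
    and "\<rho> \<ge> 2 * \<delta> * log 2 \<delta> + 38 * \<delta>"
  shows "\<exists>C' \<subseteq> C. G\<lparr>carrier := normal_closure G (\<Union>c\<in>C. Gc c)\<rparr> \<cong> free_product G C' Gc"
proof -
  interpret group G by fact
  interpret act: group_action G UNIV \<phi>
    using assms(2) unfolding isometric_action_def by blast
  have rotfam: "\<And>g c. g \<in> carrier G \<Longrightarrow> c \<in> C \<Longrightarrow> \<phi> g c \<in> C"
    "\<And>c. c \<in> C \<Longrightarrow> subgroup (Gc c) G"
    "\<And>c h. c \<in> C \<Longrightarrow> h \<in> Gc c \<Longrightarrow> \<phi> h c = c"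
    "\<And>g c. g \<in> carrier G \<Longrightarrow> c \<in> C \<Longrightarrow>
      Gc (\<phi> g c) = (\<lambda>h. g \<otimes>\<^bsub>G\<^esub> h \<otimes>\<^bsub>G\<^esub> inv\<^bsub>G\<^esub> g) ` Gc c"
    using assms(6) unfolding rotating_family_def by blast+
  have "rotation_action G \<phi> C Gc \<delta>"
  proof (intro rotation_action.intro rotation_action_axioms.intro)
    show "group G" by fact
    show "1 \<le> \<delta>" by fact
    show "min (gp w x y) (gp w y z) - \<delta> \<le> gp w x z" for w x y z :: 'a
      using hyperbolic_four_point[OF assms(3,4)] .
    show "\<phi> \<one>\<^bsub>G\<^esub> x = x" for x
      using act.id_eq_one by (metis UNIV_I restrict_apply')
    show "\<phi> (g \<otimes>\<^bsub>G\<^esub> h) x = \<phi> g (\<phi> h x)" if "g \<in> carrier G" "h \<in> carrier G" for g h x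
      using act.composition_rule[of x g h] that by simp
    show "dist (\<phi> g x) (\<phi> g y) = dist x y" if "g \<in> carrier G" for g x y
      using assms(2) that unfolding isometric_action_def by blast
    show "38 * \<delta> \<le> dist c c'" if "c \<in> C" "c' \<in> C" "c \<noteq> c'" for c c'
    proof -
      have "0 \<le> 2 * \<delta> * log 2 \<delta>" using assms(5) by simp
      moreover have "\<rho> \<le> dist c c'" using assms(7) that unfolding separated_def by blast
      ultimately show ?thesis using assms(9) by linarith
    qed
    show "gp c x (\<phi> g x) \<le> \<delta>"
      if h: "c \<in> C" "g \<in> Gc c" "g \<noteq> \<one>\<^bsub>G\<^esub>" "x \<in> C" "x \<noteq> c" for c g x
    proof -
      obtain \<gamma> t where "geodesic \<gamma> x (\<phi> g x)" "t \<in> {0..dist x (\<phi> g x)}" "dist (\<gamma> t) c \<le> 1"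
        using assms(8) h unfolding fairly_rotating_def by blast
      then have "gp c x (\<phi> g x) \<le> 1" by (rule geodesic_near_imp_gp_le)
      then show ?thesis using assms(5) by linarith
    qed
  qed (use rotfam in blast)+
  then show ?thesis by (rule rotation_action.normal_closure_free_product)
qed

end
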